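(* Let $J_0$ be the standard almost complex structure on $S^6\subset\operatorname{Im}\mathbb O$, and let $u:\mathbb{CP}^1\to(S^6,J_0)$ be an immersed pseudoholomorphic sphere that is totally geodesic with respect to the round metric. Let $g$ be a Hermitian metric on $\mathbb{CP}^1$ and $h$ a Hermitian--Einstein metric on the holomorphic normal bundle $N_u$ (with respect to $g$). Then $$\int_{\mathbb{CP}^1}|A_u^N|_{g,h}^2\,dV_g\ge2\pi,$$ and no holomorphic line subbundle $L\cong\mathcal O(-1)\subset N_u$ is invariant under $A_u^N$, i.e. satisfies $A_u^N(L)\subseteq\Lambda^{0,1}T^*\mathbb{CP}^1\otimes L$.
   Context: $S^6$ is the unit sphere in the imaginary octonions $\operatorname{Im}\mathbb O$, and $(J_0)_x(v)=x\times v$ for $v\in T_xS^6=x^\perp$, with $\times$ the octonionic cross product. Let $j$ be the complex structure of $\mathbb{CP}^1$. $u$ is pseudoholomorphic if $\bar\partial_{J_0}u:=\frac12(\mathrm du+J_0\circ\mathrm du\circ j)=0$. Its linearized operator $D_u$ is the linearization of $\bar\partial_{J_0}$ at $u$: for any connection $\nabla$ on $TS^6$ with $\nabla J_0=0$ and torsion $T$, and $U=\mathrm du(Y)$, $$D_u\xi(Y)=\tfrac12\bigl(\nabla_Y\xi+J_0\nabla_{jY}\xi\bigr)+\tfrac12\bigl(T(\xi,U)+J_0T(\xi,J_0U)\bigr).$$ For $u$ immersed, $N_u:=u^*TS^6/\mathrm du(T\mathbb{CP}^1)$ with quotient map $\pi_N$; the normal operator $D_u^N:C^\infty(N_u)\to\Omega^{0,1}(N_u)$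 is characterized by $D_u^N\pi_N=(\mathrm{id}\otimes\pi_N)D_u$. $D_u^N=\bar\partial_u^N+A_u^N$ is its decomposition into complex-linear part (defining the holomorphic structure on $N_u$) and anti-complex-linear part $A_u^N:N_u\to\Lambda^{0,1}T^*\mathbb{CP}^1\otimes N_u$ (a bundle homomorphism). $|A_u^N|_{g,h}$ is the pointwise operator norm of $A_u^N:(N_u,h)\to(\Lambda^{0,1}T^*\mathbb{CP}^1\otimes N_u,g^*\otimes h)$, with $g^*$ the Hermitian extension to complexified covectors of the dual metric of $g$; $dV_g$ is the area form. $h$ is Hermitian--Einstein if $\sqrt{-1}\Lambda_gR^{N_u,h}$ is a constant multiple of the identity, with $R^{N_u,h}$ the Chern curvature and $\Lambda_g$ the dual Lefschetz operator of $g$. *)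

theory Defs
  imports "HOL-Analysis.Analysis"
begin

section \<open>Smooth functions on open sets\<close>

primrec Ck_on :: "nat \<Rightarrow> 'a::real_normed_vector set \<Rightarrow> ('a \<Rightarrow> 'b::real_normed_vector) \<Rightarrow> bool" where
  "Ck_on 0 S f \<longleftrightarrow> continuous_on S f"
| "Ck_on (Suc k) S f \<longleftrightarrow> (\<forall>x\<in>S. f differentiable (at x)) \<and>
     (\<forall>v. Ck_on k S (\<lambda>x. frechet_derivative f (at x) v))"

definition smooth_on :: "'a::real_normed_vector set \<Rightarrow> ('a \<Rightarrow> 'b::real_normed_vector) \<Rightarrow> bool" where
  "smooth_on S f \<longleftrightarrow> (\<forall>k. Ck_on k S f)"

section \<open>The imaginary octonions and the almost complex structure of the 6-sphere\<close>

type_synonym imO = "real^7"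

text \<open>
  The basis of \<open>Im \<O>\<close> is indexed by the integers modulo 7, with
  \<open>e i * e (i+1) = e (i+3)\<close>, \<open>e (i+1) * e (i+3) = e i\<close>, \<open>e (i+3) * e i = e (i+1)\<close>.
\<close>

definition cross7 :: "imO \<Rightarrow> imO \<Rightarrow> imO" where
  "cross7 x y = (\<chi> i.
      (x $ (i+1) * y $ (i+3) - x $ (i+3) * y $ (i+1))
    + (x $ (i+2) * y $ (i+6) - x $ (i+6) * y $ (i+2))
    + (x $ (i+4) * y $ (i+5) - x $ (i+5) * y $ (i+4)))"

definition oct_mult :: "real \<times> imO \<Rightarrow> real \<times> imO \<Rightarrow> real \<times> imO" where
  "oct_mult p q = (fst p * fst q - snd p \<bullet> snd q,
                   fst p *\<^sub>R snd q + fst q *\<^sub>R snd p + cross7 (snd p) (snd q))"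

lemma UNIV_7: "(UNIV :: 7 set) = {0, 1, 2, 3, 4, 5, 6}"
proof -
  have "card {0, 1, 2, 3, 4, 5, 6 :: 7} = CARD(7)" by simp
  then show ?thesis by (metis card_subset_eq finite_class.finite_UNIV subset_UNIV)
qed

lemma sum_7: "(\<Sum>i\<in>(UNIV::7 set). f i) = f 0 + f 1 + f 2 + f 3 + f 4 + f 5 + f 6"
  unfolding UNIV_7 by (simp add: add.assoc)

lemma numerals_mod_7: "(7::7) = 0" "(8::7) = 1" "(9::7) = 2" "(10::7) = 3" "(11::7) = 4" "(12::7) = 5"
  by simp_all

lemma cross7_skew: "cross7 x y = - cross7 y x"
  by (simp add: cross7_def vec_eq_iff)

lemma cross7_orthogonal: "cross7 x y \<bullet> x = 0"
  by (simp add: inner_vec_def sum_7 cross7_def numerals_mod_7 algebra_simps)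

lemma norm_cross7: "(norm (cross7 x y))\<^sup>2 = (norm x)\<^sup>2 * (norm y)\<^sup>2 - (x \<bullet> y)\<^sup>2"
  unfolding power2_norm_eq_inner
  by (simp add: inner_vec_def sum_7 cross7_def numerals_mod_7, algebra)

text \<open>The product is multiplicative for the norm, so this algebra is the octonions.\<close>

lemma norm_oct_mult: "norm (oct_mult p q) = norm p * norm q"
proof -
  obtain a x where p: "p = (a, x)" by (cases p)
  obtain b y where q: "q = (b, y)" by (cases q)
  have xy: "x \<bullet> cross7 x y = 0" "y \<bullet> cross7 x y = 0"
    using cross7_orthogonal[of x y] cross7_orthogonal[of y x] cross7_skew[of x y]
    by (simp_all add: inner_commute)
  have "(norm (oct_mult p q))\<^sup>2 = (norm p * norm q)\<^sup>2"
    using norm_cross7[of x y] xy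
    unfolding p q oct_mult_def power2_norm_eq_inner power_mult_distrib
    by (simp add: inner_add_left inner_add_right inner_commute power2_eq_square algebra_simps)
  then show ?thesis by (simp add: power2_eq_iff_nonneg)
qed

abbreviation S6 :: "imO set" where "S6 \<equiv> sphere 0 1"

definition tangent_S6 :: "imO \<Rightarrow> imO set" where
  "tangent_S6 x = {v. v \<bullet> x = 0}"

definition J0 :: "imO \<Rightarrow> imO \<Rightarrow> imO" where
  "J0 x v = cross7 x v"

definition proj_tan :: "imO \<Rightarrow> imO \<Rightarrow> imO" where
  "proj_tan x v = v - (v \<bullet> x) *\<^sub>R x"

section \<open>Connections on the tangent bundle of the 6-sphere\<close>

text \<open>
  Functions and vector fields on \<open>S6\<close> are functions on \<open>imO\<close> of which only the values on the
  sphere matter; they are differentiated through their radially constant extension.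
\<close>

definition smooth_S6 :: "(imO \<Rightarrow> 'b::real_normed_vector) \<Rightarrow> bool" where
  "smooth_S6 f \<longleftrightarrow> smooth_on (- {0}) (\<lambda>y. f (y /\<^sub>R norm y))"

definition dS6 :: "(imO \<Rightarrow> 'b::real_normed_vector) \<Rightarrow> imO \<Rightarrow> imO \<Rightarrow> 'b" where
  "dS6 f x v = frechet_derivative (\<lambda>y. f (y /\<^sub>R norm y)) (at x) v"

definition vector_field :: "(imO \<Rightarrow> imO) \<Rightarrow> bool" where
  "vector_field X \<longleftrightarrow> smooth_S6 X \<and> (\<forall>x\<in>S6. X x \<in> tangent_S6 x)"

definition lie_bracket :: "(imO \<Rightarrow> imO) \<Rightarrow> (imO \<Rightarrow> imO) \<Rightarrow> imO \<Rightarrow> imO" where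
  "lie_bracket X Y x = dS6 Y x (X x) - dS6 X x (Y x)"

text \<open>\<open>nabla X x v\<close> is the covariant derivative at \<open>x\<close> of the vector field \<open>X\<close> in direction \<open>v\<close>.\<close>

type_synonym connection = "(imO \<Rightarrow> imO) \<Rightarrow> imO \<Rightarrow> imO \<Rightarrow> imO"

definition connection_S6 :: "connection \<Rightarrow> bool" where
  "connection_S6 nabla \<longleftrightarrow>
     (\<forall>X V. vector_field X \<and> vector_field V \<longrightarrow> vector_field (\<lambda>x. nabla X x (V x))) \<and>
     (\<forall>X. vector_field X \<longrightarrow> (\<forall>x\<in>S6. \<forall>v\<in>tangent_S6 x. \<forall>w\<in>tangent_S6 x. \<forall>a b.
        nabla X x v \<in> tangent_S6 x \<and>
        nabla X x (a *\<^sub>R v + b *\<^sub>R w) = a *\<^sub>R nabla X x v + b *\<^sub>R nabla X x w)) \<and>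
     (\<forall>X Y. vector_field X \<and> vector_field Y \<longrightarrow> (\<forall>x\<in>S6. \<forall>v\<in>tangent_S6 x.
        nabla (\<lambda>y. X y + Y y) x v = nabla X x v + nabla Y x v)) \<and>
     (\<forall>f X. smooth_S6 f \<and> vector_field X \<longrightarrow> (\<forall>x\<in>S6. \<forall>v\<in>tangent_S6 x.
        nabla (\<lambda>y. f y *\<^sub>R X y) x v = dS6 f x v *\<^sub>R X x + f x *\<^sub>R nabla X x v))"

definition J0_connection :: "connection \<Rightarrow> bool" where
  "J0_connection nabla \<longleftrightarrow> connection_S6 nabla \<and>
     (\<forall>X. vector_field X \<longrightarrow> (\<forall>x\<in>S6. \<forall>v\<in>tangent_S6 x.
        nabla (\<lambda>y. J0 y (X y)) x v = J0 x (nabla X x v)))"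

text \<open>The torsion is a tensor; it is evaluated on \<open>v\<close>, \<open>w\<close> through the vector fields
  \<open>\<lambda>y. proj_tan y v\<close> and \<open>\<lambda>y. proj_tan y w\<close> that extend them.\<close>

definition torsion :: "connection \<Rightarrow> imO \<Rightarrow> imO \<Rightarrow> imO \<Rightarrow> imO" where
  "torsion nabla x v w =
     nabla (\<lambda>y. proj_tan y w) x v - nabla (\<lambda>y. proj_tan y v) x w
     - lie_bracket (\<lambda>y. proj_tan y v) (\<lambda>y. proj_tan y w) x"

section \<open>The complex projective line\<close>

typedef cp1 = "{L :: (complex \<times> complex) set. \<exists>v. v \<noteq> 0 \<and> L = {(c * fst v, c * snd v) | c. True}}"
  morphisms line_of cp1_of
proof -
  have "(1, 0) \<noteq> (0 :: complex \<times> complex)" by (simp add: zero_prod_def)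
  then show ?thesis by blast
qed

datatype chart = Ch0 | Ch1

fun frame :: "chart \<Rightarrow> complex \<Rightarrow> complex \<times> complex" where
  "frame Ch0 z = (1, z)"
| "frame Ch1 z = (z, 1)"

definition pt :: "chart \<Rightarrow> complex \<Rightarrow> cp1" where
  "pt b z = cp1_of {(c * fst (frame b z), c * snd (frame b z)) | c. True}"

definition coord :: "chart \<Rightarrow> cp1 \<Rightarrow> complex" where
  "coord b p = (THE z. pt b z = p)"

lemma pt_transition:
  assumes "z \<noteq> 0" shows "pt Ch0 z = pt Ch1 (1 / z)"
proof -
  have "{(c * 1, c * z) | c. True} = {(c * (1 / z), c * 1) | c. True}"
  proof safe
    fix c show "\<exists>d. (c * 1, c * z) = (d * (1 / z), d * 1) \<and> True"
      using assms by (intro exI[of _ "c * z"]) simp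
  next
    fix c show "\<exists>d. (c * (1 / z), c * 1) = (d * 1, d * z) \<and> True"
      using assms by (intro exI[of _ "c / z"]) simp
  qed
  then show ?thesis by (simp add: pt_def)
qed

text \<open>
  A tangent vector of \<open>cp1\<close> at \<open>pt b z\<close> is given by its coordinate \<open>Y :: complex\<close> in the chart
  \<open>b\<close>, so that \<open>j Y = \<i> * Y\<close>; the tangent vector \<open>Y\<close> at \<open>z\<close> in \<open>Ch0\<close> is \<open>- Y / z\<^sup>2\<close> at \<open>1 / z\<close> in
  \<open>Ch1\<close>. A metric on \<open>cp1\<close> is given by its expressions in the two charts.
\<close>

definition hermitian_metric_cp1 :: "(chart \<Rightarrow> complex \<Rightarrow> complex \<Rightarrow> complex \<Rightarrow> real) \<Rightarrow> bool" where
  "hermitian_metric_cp1 g \<longleftrightarrow>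
     (\<forall>b Y Z. smooth_on UNIV (\<lambda>z. g b z Y Z)) \<and>
     (\<forall>b z. bilinear (g b z)) \<and>
     (\<forall>b z Y Z. g b z Y Z = g b z Z Y) \<and>
     (\<forall>b z Y. Y \<noteq> 0 \<longrightarrow> g b z Y Y > 0) \<and>
     (\<forall>b z Y Z. g b z (\<i> * Y) (\<i> * Z) = g b z Y Z) \<and>
     (\<forall>z Y Z. z \<noteq> 0 \<longrightarrow> g Ch0 z Y Z = g Ch1 (1 / z) (- Y / z\<^sup>2) (- Z / z\<^sup>2))"

text \<open>The density of the area form of \<open>g\<close> with respect to the coordinate area form.\<close>

definition area_density :: "(chart \<Rightarrow> complex \<Rightarrow> complex \<Rightarrow> complex \<Rightarrow> real) \<Rightarrow> chart \<Rightarrow> complex \<Rightarrow> real" where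
  "area_density g b z = sqrt (g b z 1 1 * g b z \<i> \<i> - (g b z 1 \<i>)\<^sup>2)"

text \<open>The chart \<open>Ch0\<close> misses only one point of \<open>cp1\<close>, which has measure zero.\<close>

definition integral_cp1 ::
    "(chart \<Rightarrow> complex \<Rightarrow> complex \<Rightarrow> complex \<Rightarrow> real) \<Rightarrow> (chart \<Rightarrow> complex \<Rightarrow> real) \<Rightarrow> ennreal" where
  "integral_cp1 g f = (\<integral>\<^sup>+ z. ennreal (f Ch0 z * area_density g Ch0 z) \<partial>lborel)"

section \<open>Pseudoholomorphic spheres\<close>

definition du :: "(cp1 \<Rightarrow> imO) \<Rightarrow> chart \<Rightarrow> complex \<Rightarrow> complex \<Rightarrow> imO" where
  "du u b z Y = frechet_derivative (\<lambda>w. u (pt b w)) (at z) Y"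

definition dbar_J0 :: "(cp1 \<Rightarrow> imO) \<Rightarrow> chart \<Rightarrow> complex \<Rightarrow> complex \<Rightarrow> imO" where
  "dbar_J0 u b z Y = (1/2) *\<^sub>R (du u b z Y + J0 (u (pt b z)) (du u b z (\<i> * Y)))"

definition pseudoholomorphic :: "(cp1 \<Rightarrow> imO) \<Rightarrow> bool" where
  "pseudoholomorphic u \<longleftrightarrow> range u \<subseteq> S6 \<and> (\<forall>b. smooth_on UNIV (\<lambda>z. u (pt b z))) \<and>
     (\<forall>b z Y. dbar_J0 u b z Y = 0)"

definition immersed :: "(cp1 \<Rightarrow> imO) \<Rightarrow> bool" where
  "immersed u \<longleftrightarrow> (\<forall>b z. inj (du u b z))"

section \<open>The normal bundle\<close>

text \<open>
  The fibre of the normal bundle at \<open>p\<close> is the quotient of \<open>tangent_S6 (u p)\<close> by \<open>du_image u p\<close>;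
  its elements are cosets. Scalars act on it through \<open>J0\<close>.
\<close>

type_synonym ncls = "imO set"

definition du_image :: "(cp1 \<Rightarrow> imO) \<Rightarrow> cp1 \<Rightarrow> imO set" where
  "du_image u p = {du u b z Y | b z Y. pt b z = p}"

definition nclass :: "(cp1 \<Rightarrow> imO) \<Rightarrow> cp1 \<Rightarrow> imO \<Rightarrow> ncls" where
  "nclass u p v = {v + t | t. t \<in> du_image u p}"

definition nfibre :: "(cp1 \<Rightarrow> imO) \<Rightarrow> cp1 \<Rightarrow> ncls set" where
  "nfibre u p = nclass u p ` tangent_S6 (u p)"

definition nzero :: "(cp1 \<Rightarrow> imO) \<Rightarrow> cp1 \<Rightarrow> ncls" where
  "nzero u p = nclass u p 0"

definition nadd :: "ncls \<Rightarrow> ncls \<Rightarrow> ncls" where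
  "nadd A B = {a + b | a b. a \<in> A \<and> b \<in> B}"

definition nscale :: "(cp1 \<Rightarrow> imO) \<Rightarrow> cp1 \<Rightarrow> complex \<Rightarrow> ncls \<Rightarrow> ncls" where
  "nscale u p c A = {Re c *\<^sub>R a + Im c *\<^sub>R J0 (u p) a + t | a t. a \<in> A \<and> t \<in> du_image u p}"

text \<open>The second fundamental form for the round metric: its Levi-Civita connection is the
  tangential part of the derivative in \<open>imO\<close>.\<close>

definition second_ff :: "(cp1 \<Rightarrow> imO) \<Rightarrow> chart \<Rightarrow> complex \<Rightarrow> complex \<Rightarrow> complex \<Rightarrow> ncls" where
  "second_ff u b z Y Z = nclass u (pt b z)
     (proj_tan (u (pt b z)) (frechet_derivative (\<lambda>w. du u b w Z) (at z) Y))"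

definition totally_geodesic :: "(cp1 \<Rightarrow> imO) \<Rightarrow> bool" where
  "totally_geodesic u \<longleftrightarrow> (\<forall>b z Y Z. second_ff u b z Y Z = nzero u (pt b z))"

text \<open>Smooth sections over the open set \<open>pt b ` V\<close>.\<close>

definition pullback_section :: "(cp1 \<Rightarrow> imO) \<Rightarrow> chart \<Rightarrow> complex set \<Rightarrow> (cp1 \<Rightarrow> imO) \<Rightarrow> bool" where
  "pullback_section u b V \<xi> \<longleftrightarrow> open V \<and> smooth_on V (\<lambda>w. \<xi> (pt b w)) \<and>
     (\<forall>w\<in>V. \<xi> (pt b w) \<in> tangent_S6 (u (pt b w)))"

definition lift_of :: "(cp1 \<Rightarrow> imO) \<Rightarrow> chart \<Rightarrow> complex set \<Rightarrow> (cp1 \<Rightarrow> imO) \<Rightarrow> (cp1 \<Rightarrow> ncls) \<Rightarrow> bool" where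
  "lift_of u b V \<xi> s \<longleftrightarrow> pullback_section u b V \<xi> \<and>
     (\<forall>w\<in>V. s (pt b w) = nclass u (pt b w) (\<xi> (pt b w)))"

definition normal_section :: "(cp1 \<Rightarrow> imO) \<Rightarrow> chart \<Rightarrow> complex set \<Rightarrow> (cp1 \<Rightarrow> ncls) \<Rightarrow> bool" where
  "normal_section u b V s \<longleftrightarrow> (\<exists>\<xi>. lift_of u b V \<xi> s)"

section \<open>The linearized operator and the normal operator\<close>

text \<open>
  The pulled back connection on \<open>u\<^sup>* T S6\<close>. With the vector fields \<open>E k = (\<lambda>y. proj_tan y (axis k 1))\<close>
  one has \<open>\<xi> = (\<Sum>k. \<xi> $ k *\<^sub>R E k \<circ> u)\<close>, and the Leibniz rule gives
  \<open>(\<Sum>k. d (\<xi> $ k) Y *\<^sub>R E k (u p) + \<xi> $ k *\<^sub>R nabla (E k) (u p) (du Y))\<close>; this is the sum below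
  because \<open>proj_tan\<close> and \<open>nabla\<close> are linear.
\<close>

definition pullback_conn ::
    "connection \<Rightarrow> (cp1 \<Rightarrow> imO) \<Rightarrow> (cp1 \<Rightarrow> imO) \<Rightarrow> chart \<Rightarrow> complex \<Rightarrow> complex \<Rightarrow> imO" where
  "pullback_conn nabla u \<xi> b z Y =
     proj_tan (u (pt b z)) (frechet_derivative (\<lambda>w. \<xi> (pt b w)) (at z) Y)
     + nabla (\<lambda>y. proj_tan y (\<xi> (pt b z))) (u (pt b z)) (du u b z Y)"

definition lin_op ::
    "connection \<Rightarrow> (cp1 \<Rightarrow> imO) \<Rightarrow> (cp1 \<Rightarrow> imO) \<Rightarrow> chart \<Rightarrow> complex \<Rightarrow> complex \<Rightarrow> imO" where
  "lin_op nabla u \<xi> b z Y =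
     (let x = u (pt b z); v = \<xi> (pt b z); U = du u b z Y in
       (1/2) *\<^sub>R (pullback_conn nabla u \<xi> b z Y + J0 x (pullback_conn nabla u \<xi> b z (\<i> * Y)))
       + (1/2) *\<^sub>R (torsion nabla x v U + J0 x (torsion nabla x v (J0 x U))))"

text \<open>The normal operator is determined by its values on projections of sections of \<open>u\<^sup>* T S6\<close>.\<close>

definition normal_op ::
    "connection \<Rightarrow> (cp1 \<Rightarrow> imO) \<Rightarrow> (cp1 \<Rightarrow> ncls) \<Rightarrow> chart \<Rightarrow> complex \<Rightarrow> complex \<Rightarrow> ncls" where
  "normal_op nabla u s b z Y = (THE m. \<forall>\<xi> V. z \<in> V \<and> lift_of u b V \<xi> s \<longrightarrow>
     m = nclass u (pt b z) (lin_op nabla u \<xi> b z Y))"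

text \<open>The complex-linear and the anti-complex-linear part of the normal operator.\<close>

definition dbar_normal ::
    "connection \<Rightarrow> (cp1 \<Rightarrow> imO) \<Rightarrow> (cp1 \<Rightarrow> ncls) \<Rightarrow> chart \<Rightarrow> complex \<Rightarrow> complex \<Rightarrow> ncls" where
  "dbar_normal nabla u s b z Y = nscale u (pt b z) (1/2)
     (nadd (normal_op nabla u s b z Y)
           (nscale u (pt b z) (- \<i>) (normal_op nabla u (\<lambda>p. nscale u p \<i> (s p)) b z Y)))"

definition antilinear_part ::
    "connection \<Rightarrow> (cp1 \<Rightarrow> imO) \<Rightarrow> (cp1 \<Rightarrow> ncls) \<Rightarrow> chart \<Rightarrow> complex \<Rightarrow> complex \<Rightarrow> ncls" where
  "antilinear_part nabla u s b z Y = nscale u (pt b z) (1/2)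
     (nadd (normal_op nabla u s b z Y)
           (nscale u (pt b z) \<i> (normal_op nabla u (\<lambda>p. nscale u p \<i> (s p)) b z Y)))"

text \<open>The anti-complex-linear part is of order zero: \<open>A_normal\<close> is the corresponding bundle
  homomorphism, evaluated at \<open>n \<in> nfibre u (pt b z)\<close> and at the tangent vector \<open>Y\<close>.\<close>

definition A_normal ::
    "connection \<Rightarrow> (cp1 \<Rightarrow> imO) \<Rightarrow> chart \<Rightarrow> complex \<Rightarrow> ncls \<Rightarrow> complex \<Rightarrow> ncls" where
  "A_normal nabla u b z n Y = (THE m. \<forall>s V. z \<in> V \<and> normal_section u b V s \<and> s (pt b z) = n \<longrightarrow>
     m = antilinear_part nabla u s b z Y)"

section \<open>Hermitian metrics on the normal bundle\<close>

definition hermitian_metric_normal :: "(cp1 \<Rightarrow> imO) \<Rightarrow> (cp1 \<Rightarrow> ncls \<Rightarrow> ncls \<Rightarrow> complex) \<Rightarrow> bool" where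
  "hermitian_metric_normal u h \<longleftrightarrow>
     (\<forall>p. \<forall>n\<in>nfibre u p. \<forall>m\<in>nfibre u p.
        (\<forall>k\<in>nfibre u p. h p (nadd n k) m = h p n m + h p k m) \<and>
        (\<forall>c. h p (nscale u p c n) m = c * h p n m) \<and>
        h p m n = cnj (h p n m) \<and>
        (n \<noteq> nzero u p \<longrightarrow> Re (h p n n) > 0)) \<and>
     (\<forall>b V s t. normal_section u b V s \<and> normal_section u b V t \<longrightarrow>
        smooth_on V (\<lambda>z. h (pt b z) (s (pt b z)) (t (pt b z))))"

text \<open>\<open>D s b z Y\<close> is the covariant derivative of \<open>s\<close> at \<open>pt b z\<close> in direction \<open>Y\<close>.\<close>

type_synonym nconnection = "(cp1 \<Rightarrow> ncls) \<Rightarrow> chart \<Rightarrow> complex \<Rightarrow> complex \<Rightarrow> ncls"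

definition along :: "nconnection \<Rightarrow> (cp1 \<Rightarrow> ncls) \<Rightarrow> chart \<Rightarrow> complex \<Rightarrow> cp1 \<Rightarrow> ncls" where
  "along D s b Y = (\<lambda>p. D s b (coord b p) Y)"

definition normal_connection :: "(cp1 \<Rightarrow> imO) \<Rightarrow> nconnection \<Rightarrow> bool" where
  "normal_connection u D \<longleftrightarrow>
     (\<forall>b V s. normal_section u b V s \<longrightarrow>
        (\<forall>Y. normal_section u b V (along D s b Y)) \<and>
        (\<forall>z\<in>V. \<forall>Y Z. D s b z (Y + Z) = nadd (D s b z Y) (D s b z Z)) \<and>
        (\<forall>z\<in>V. \<forall>Y. \<forall>r::real. D s b z (of_real r * Y) = nscale u (pt b z) (of_real r) (D s b z Y)) \<and>
        (\<forall>z\<in>V. \<forall>Y. \<forall>t. normal_section u b V t \<longrightarrow>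
           D (\<lambda>p. nadd (s p) (t p)) b z Y = nadd (D s b z Y) (D t b z Y)) \<and>
        (\<forall>z\<in>V. \<forall>Y. \<forall>t. (\<forall>w\<in>V. t (pt b w) = s (pt b w)) \<longrightarrow> D t b z Y = D s b z Y) \<and>
        (\<forall>z\<in>V. \<forall>Y. \<forall>f :: cp1 \<Rightarrow> complex. smooth_on V (\<lambda>w. f (pt b w)) \<longrightarrow>
           D (\<lambda>p. nscale u p (f p) (s p)) b z Y =
             nadd (nscale u (pt b z) (frechet_derivative (\<lambda>w. f (pt b w)) (at z) Y) (s (pt b z)))
                  (nscale u (pt b z) (f (pt b z)) (D s b z Y)))) \<and>
     (\<forall>V s. normal_section u Ch0 V s \<longrightarrow> (\<forall>z\<in>V. \<forall>Y. z \<noteq> 0 \<longrightarrow>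
        D s Ch0 z Y = D s Ch1 (1 / z) (- Y / z\<^sup>2)))"

definition chern_connection ::
    "connection \<Rightarrow> (cp1 \<Rightarrow> imO) \<Rightarrow> (cp1 \<Rightarrow> ncls \<Rightarrow> ncls \<Rightarrow> complex) \<Rightarrow> nconnection \<Rightarrow> bool" where
  "chern_connection nabla u h D \<longleftrightarrow> normal_connection u D \<and>
     (\<forall>b V s t. normal_section u b V s \<and> normal_section u b V t \<longrightarrow> (\<forall>z\<in>V. \<forall>Y.
        frechet_derivative (\<lambda>w. h (pt b w) (s (pt b w)) (t (pt b w))) (at z) Y =
          h (pt b z) (D s b z Y) (t (pt b z)) + h (pt b z) (s (pt b z)) (D t b z Y))) \<and>
     (\<forall>b V s. normal_section u b V s \<longrightarrow> (\<forall>z\<in>V. \<forall>Y.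
        nscale u (pt b z) (1/2) (nadd (D s b z Y) (nscale u (pt b z) \<i> (D s b z (\<i> * Y))))
          = dbar_normal nabla u s b z Y))"

text \<open>The curvature \<open>R (\<partial>x, \<partial>y) s\<close> for the coordinate vector fields of the chart \<open>b\<close>, which commute.\<close>

definition curvature_xy ::
    "(cp1 \<Rightarrow> imO) \<Rightarrow> nconnection \<Rightarrow> (cp1 \<Rightarrow> ncls) \<Rightarrow> chart \<Rightarrow> complex \<Rightarrow> ncls" where
  "curvature_xy u D s b z = nadd (D (along D s b \<i>) b z 1)
     (nscale u (pt b z) (- 1) (D (along D s b 1) b z \<i>))"

text \<open>In complex dimension one, a 2-form \<open>\<beta>\<close> is \<open>\<Lambda> \<beta>\<close> times the area form.\<close>

definition Lambda_curvature ::
    "(chart \<Rightarrow> complex \<Rightarrow> complex \<Rightarrow> complex \<Rightarrow> real) \<Rightarrow> (cp1 \<Rightarrow> imO) \<Rightarrow> nconnection \<Rightarrow>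
     (cp1 \<Rightarrow> ncls) \<Rightarrow> chart \<Rightarrow> complex \<Rightarrow> ncls" where
  "Lambda_curvature g u D s b z =
     nscale u (pt b z) (of_real (1 / area_density g b z)) (curvature_xy u D s b z)"

definition hermitian_einstein ::
    "connection \<Rightarrow> (cp1 \<Rightarrow> imO) \<Rightarrow> (chart \<Rightarrow> complex \<Rightarrow> complex \<Rightarrow> complex \<Rightarrow> real) \<Rightarrow>
     (cp1 \<Rightarrow> ncls \<Rightarrow> ncls \<Rightarrow> complex) \<Rightarrow> bool" where
  "hermitian_einstein nabla u g h \<longleftrightarrow> hermitian_metric_normal u h \<and>
     (\<exists>D. chern_connection nabla u h D \<and>
       (\<exists>c::real. \<forall>b V s. normal_section u b V s \<longrightarrow> (\<forall>z\<in>V.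
          nscale u (pt b z) \<i> (Lambda_curvature g u D s b z)
            = nscale u (pt b z) (of_real c) (s (pt b z)))))"

text \<open>
  The squared norm, for the Hermitian extension of \<open>g\<^sup>*\<close> tensored with \<open>h\<close>, of a normal bundle
  valued covector \<open>\<beta>\<close>: the sum of \<open>h (\<beta> e) (\<beta> e)\<close> over a \<open>g\<close>-orthonormal basis, here the
  normalizations of the orthogonal vectors \<open>1\<close> and \<open>\<i>\<close>.
\<close>

definition form_norm2 ::
    "(chart \<Rightarrow> complex \<Rightarrow> complex \<Rightarrow> complex \<Rightarrow> real) \<Rightarrow> (cp1 \<Rightarrow> ncls \<Rightarrow> ncls \<Rightarrow> complex) \<Rightarrow>
     chart \<Rightarrow> complex \<Rightarrow> (complex \<Rightarrow> ncls) \<Rightarrow> real" where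
  "form_norm2 g h b z \<beta> = (\<Sum>Y\<in>{1, \<i>}. Re (h (pt b z) (\<beta> Y) (\<beta> Y)) / g b z Y Y)"

definition A_opnorm ::
    "connection \<Rightarrow> (cp1 \<Rightarrow> imO) \<Rightarrow> (chart \<Rightarrow> complex \<Rightarrow> complex \<Rightarrow> complex \<Rightarrow> real) \<Rightarrow>
     (cp1 \<Rightarrow> ncls \<Rightarrow> ncls \<Rightarrow> complex) \<Rightarrow> chart \<Rightarrow> complex \<Rightarrow> real" where
  "A_opnorm nabla u g h b z =
     (SUP n\<in>{n \<in> nfibre u (pt b z). h (pt b z) n n = 1}.
        sqrt (form_norm2 g h b z (A_normal nabla u b z n)))"

section \<open>Holomorphic line subbundles\<close>

definition holomorphic_section ::
    "connection \<Rightarrow> (cp1 \<Rightarrow> imO) \<Rightarrow> chart \<Rightarrow> complex set \<Rightarrow> (cp1 \<Rightarrow> ncls) \<Rightarrow> bool" where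
  "holomorphic_section nabla u b V s \<longleftrightarrow> normal_section u b V s \<and>
     (\<forall>z\<in>V. \<forall>Y. dbar_normal nabla u s b z Y = nzero u (pt b z))"

definition holomorphic_line_subbundle ::
    "connection \<Rightarrow> (cp1 \<Rightarrow> imO) \<Rightarrow> (cp1 \<Rightarrow> ncls set) \<Rightarrow> bool" where
  "holomorphic_line_subbundle nabla u L \<longleftrightarrow>
     (\<forall>b z. \<exists>V s. z \<in> V \<and> holomorphic_section nabla u b V s \<and>
        (\<forall>w\<in>V. s (pt b w) \<noteq> nzero u (pt b w) \<and>
               L (pt b w) = {nscale u (pt b w) c (s (pt b w)) | c. True}))"

text \<open>
  \<open>\<O>(-1)\<close> is the tautological bundle, whose fibre at \<open>p\<close> is the line \<open>line_of p\<close> and which has the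
  holomorphic frames \<open>\<lambda>p. frame b (coord b p)\<close>. A fibrewise linear bijection to \<open>L\<close> is an
  isomorphism of holomorphic bundles iff it sends these frames to holomorphic sections.
\<close>

definition isomorphic_O_minus_1 ::
    "connection \<Rightarrow> (cp1 \<Rightarrow> imO) \<Rightarrow> (cp1 \<Rightarrow> ncls set) \<Rightarrow> bool" where
  "isomorphic_O_minus_1 nabla u L \<longleftrightarrow>
     (\<exists>\<psi> :: cp1 \<Rightarrow> complex \<times> complex \<Rightarrow> ncls.
       (\<forall>p. bij_betw (\<psi> p) (line_of p) (L p) \<and>
          (\<forall>v\<in>line_of p. \<forall>w\<in>line_of p. \<psi> p (v + w) = nadd (\<psi> p v) (\<psi> p w)) \<and>
          (\<forall>v\<in>line_of p. \<forall>c. \<psi> p (c * fst v, c * snd v) = nscale u p c (\<psi> p v))) \<and>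
       (\<forall>b. holomorphic_section nabla u b UNIV (\<lambda>p. \<psi> p (frame b (coord b p)))))"

definition A_invariant :: "connection \<Rightarrow> (cp1 \<Rightarrow> imO) \<Rightarrow> (cp1 \<Rightarrow> ncls set) \<Rightarrow> bool" where
  "A_invariant nabla u L \<longleftrightarrow>
     (\<forall>b z. \<forall>n\<in>L (pt b z). \<forall>Y. A_normal nabla u b z n Y \<in> L (pt b z))"

end

theory Submission
  imports Defs
begin

text \<open>The source of A is the variation of \<open>J0\<close>: the derivative of x \<times> w in
  direction v is v \<times> w, and this is all that an arbitrary connection preserving
  \<open>J0\<close> leaves behind in the linearized operator. On the normal bundle, a section
  becomes a function with values in the fixed space V, which can be differentiated componentwise,
  whereas multiplication by the imaginary unit is still x \<times> and moves with the point.
  Comparing the operator on a section and on its multiple by the imaginary unit therefore cancels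
  all derivatives of the section and isolates A.

  In the constant, 2 comes from the pointwise norm, to which the two orthogonal directions of a
  chart contribute equally, and \<pi> is the area of the disc. The factor of g in the norm is
  inverse to its area density, so g disappears before integration. Aiming at a single disc keeps the
  area bound elementary: an open and closed argument in the plane takes the place of degrees and
  coverings.\<close>

text \<open>
  A totally geodesic pseudoholomorphic sphere takes values in a fixed 3-dimensional associative
  subspace of the imaginary octonions, so that its normal spaces are all identified with the
  orthogonal complement \<open>V\<close> of that subspace. In this picture \<open>A Y v = x \<times> (U \<times> v)\<close> with
  \<open>x = u z\<close> and \<open>U = du Y\<close>, and the Clifford relations on \<open>V\<close> give \<open>A Y \<circ> A Y = - \<bar>U\<bar>\<^sup>2\<close>. Since \<open>A Y\<close>
  is anti-linear, its square would be a nonnegative scalar on an invariant complex line, so no line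
  is invariant, not even at a single point. The same identity bounds the operator norm of \<open>A Y\<close> from
  below by \<open>\<bar>U\<bar>\<close> for every Hermitian metric, so that the integral is at least twice the area of
  \<open>u\<close>. The area is at least that of the unit disc, because the orthogonal projection of the sphere
  to a suitable plane covers the disc up to one point.
\<close>

section \<open>The cross product\<close>

lemma bounded_bilinear_cross7: "bounded_bilinear cross7"
proof -
  have "bilinear cross7"
    unfolding bilinear_def linear_iff
    by (simp add: cross7_def vec_eq_iff algebra_simps)
  then show ?thesis by (simp add: bilinear_conv_bounded_bilinear)
qed

interpretation cross7: bounded_bilinear cross7 by (rule bounded_bilinear_cross7)

lemma cross7_self [simp]: "cross7 x x = 0"
  by (simp add: cross7_def vec_eq_iff)

text \<open>Polarization of orthogonality: multiplication by \<open>y\<close> is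
  skew-adjoint.\<close>

lemma inner_cross7_right: "x \<bullet> cross7 y z = - (cross7 y x \<bullet> z)"
proof -
  have "cross7 y (x + z) \<bullet> (x + z) = 0" "cross7 y x \<bullet> x = 0" "cross7 y z \<bullet> z = 0"
    using cross7_orthogonal cross7_skew by (metis inner_minus_left neg_equal_0_iff_equal)+
  then show ?thesis
    by (simp add: cross7.add_right inner_add_left inner_add_right inner_commute)
qed

lemma cross7_inner_left [simp]: "cross7 x y \<bullet> x = 0" "cross7 x y \<bullet> y = 0"
    "x \<bullet> cross7 x y = 0" "y \<bullet> cross7 x y = 0"
  using cross7_orthogonal[of x y] cross7_orthogonal[of y x] cross7_skew[of x y]
  by (simp_all add: inner_commute)

text \<open>Pair with an arbitrary \<open>w\<close>: by skew-adjointness the left side becomes an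
  inner product of two products with \<open>x\<close>, which polarizing \<open>norm_cross7\<close>
  evaluates.\<close>

lemma cross7_cross7: "cross7 x (cross7 x v) = (x \<bullet> v) *\<^sub>R x - (x \<bullet> x) *\<^sub>R v"
proof -
  have "w \<bullet> cross7 x (cross7 x v) = w \<bullet> ((x \<bullet> v) *\<^sub>R x - (x \<bullet> x) *\<^sub>R v)" for w
  proof -
    have n: "cross7 x y \<bullet> cross7 x y = (x \<bullet> x) * (y \<bullet> y) - (x \<bullet> y)\<^sup>2" for y
      using norm_cross7[of x y] by (simp add: power2_norm_eq_inner)
    have "cross7 x w \<bullet> cross7 x v = (x \<bullet> x) * (w \<bullet> v) - (x \<bullet> w) * (x \<bullet> v)"
      using n[of "w + v"] n[of w] n[of v]
      by (simp add: cross7.add_right inner_add_left inner_add_right inner_commute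
          power2_eq_square algebra_simps)
    then show ?thesis
      unfolding inner_cross7_right by (simp add: inner_diff_right inner_commute)
  qed
  then show ?thesis by (metis vector_eq_rdot inner_commute)
qed

text \<open>Polarization of \<open>cross7_cross7\<close> in \<open>x\<close>.\<close>

lemma cross7_clifford:
  "cross7 x (cross7 y v) + cross7 y (cross7 x v)
    = (x \<bullet> v) *\<^sub>R y + (y \<bullet> v) *\<^sub>R x - (2 * (x \<bullet> y)) *\<^sub>R v"
  using cross7_cross7[of "x + y" v] cross7_cross7[of x v] cross7_cross7[of y v]
  by (simp add: cross7.add_right cross7.add_left inner_add_left inner_add_right inner_commute
      algebra_simps)

section \<open>Functions of class Ck\<close>

lemma Ck_on_subset: "Ck_on k S f \<Longrightarrow> T \<subseteq> S \<Longrightarrow> Ck_on k T f"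
  by (induction k arbitrary: f) (auto intro: continuous_on_subset)

lemma Ck_on_SucD: "Ck_on (Suc k) S f \<Longrightarrow> Ck_on k S f"
proof (induction k arbitrary: f)
  case 0
  then show ?case
    by (simp add: continuous_at_imp_continuous_on differentiable_imp_continuous_within)
next
  case (Suc k)
  then show ?case by (metis Ck_on.simps(2))
qed

text \<open>Openness enters because the derivative at a point depends on the function in a
  neighbourhood.\<close>

lemma Ck_on_cong:
  assumes "open S" and "\<And>x. x \<in> S \<Longrightarrow> f x = g x"
  shows "Ck_on k S f \<longleftrightarrow> Ck_on k S g"
  using assms(2)
proof (induction k arbitrary: f g)
  case 0
  then show ?case by (auto cong: continuous_on_cong)
next
  case (Suc k)
  have *: "f differentiable at x \<longleftrightarrow> g differentiable at x"
       "f differentiable at x \<Longrightarrow> frechet_derivative f (at x) = frechet_derivative g (at x)"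
    if "x \<in> S" for x
  proof -
    show 1: "f differentiable at x \<longleftrightarrow> g differentiable at x"
      unfolding differentiable_def
      using has_derivative_transform_within_open[OF _ assms(1) that] Suc.prems by metis
    show "f differentiable at x \<Longrightarrow> frechet_derivative f (at x) = frechet_derivative g (at x)"
      using frechet_derivative_transform_within_open[OF _ assms(1) that] Suc.prems by metis
  qed
  show ?case
  proof -
    have "(\<forall>x\<in>S. f differentiable at x) \<longleftrightarrow> (\<forall>x\<in>S. g differentiable at x)" using * by blast
    moreover have "Ck_on k S (\<lambda>x. frechet_derivative f (at x) v)
        \<longleftrightarrow> Ck_on k S (\<lambda>x. frechet_derivative g (at x) v)"
      if "\<forall>x\<in>S. f differentiable at x" for v
      using that * by (intro Suc.IH) metis
    ultimately show ?thesis by auto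
  qed
qed

lemma Ck_on_SucI:
  assumes "open S" and "\<And>x. x \<in> S \<Longrightarrow> (f has_derivative f' x) (at x)"
    and "\<And>v. Ck_on k S (\<lambda>x. f' x v)"
  shows "Ck_on (Suc k) S f"
proof -
  have "frechet_derivative f (at x) = f' x" if "x \<in> S" for x
    using frechet_derivative_at[OF assms(2)[OF that]] by simp
  then have "Ck_on k S (\<lambda>x. frechet_derivative f (at x) v) \<longleftrightarrow> Ck_on k S (\<lambda>x. f' x v)" for v
    by (intro Ck_on_cong assms(1)) simp
  with assms(2,3) show ?thesis by (auto simp: differentiable_def)
qed

lemma Ck_on_has_derivative:
  "Ck_on (Suc k) S f \<Longrightarrow> x \<in> S \<Longrightarrow> (f has_derivative frechet_derivative f (at x)) (at x)"
  by (simp add: frechet_derivative_works)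

lemma Ck_on_const: "open S \<Longrightarrow> Ck_on k S (\<lambda>x. c)"
proof (induction k arbitrary: c)
  case (Suc k)
  show ?case by (rule Ck_on_SucI[where f' = "\<lambda>x v. 0"]) (use Suc in auto)
qed simp

lemma Ck_on_linear:
  assumes "open S" "bounded_linear L" "Ck_on k S f"
  shows "Ck_on k S (\<lambda>x. L (f x))"
  using assms(3)
proof (induction k arbitrary: f)
  case 0
  then show ?case using bounded_linear.continuous_on[OF assms(2)] by simp
next
  case (Suc k)
  show ?case
  proof (rule Ck_on_SucI[OF assms(1)])
    show "((\<lambda>x. L (f x)) has_derivative (\<lambda>v. L (frechet_derivative f (at x) v))) (at x)"
      if "x \<in> S" for x
      by (rule bounded_linear.has_derivative[OF assms(2) Ck_on_has_derivative[OF Suc.prems that]])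
    show "Ck_on k S (\<lambda>x. L (frechet_derivative f (at x) v))" for v
      using Suc by simp
  qed
qed

lemma Ck_on_add:
  assumes "open S" "Ck_on k S f" "Ck_on k S g"
  shows "Ck_on k S (\<lambda>x. f x + g x)"
  using assms(2,3)
proof (induction k arbitrary: f g)
  case 0
  then show ?case by (simp add: continuous_on_add)
next
  case (Suc k)
  show ?case
  proof (rule Ck_on_SucI[OF assms(1)])
    show "((\<lambda>x. f x + g x) has_derivative
        (\<lambda>v. frechet_derivative f (at x) v + frechet_derivative g (at x) v)) (at x)"
      if "x \<in> S" for x
      using Suc.prems that by (intro has_derivative_add) (auto intro: Ck_on_has_derivative)
  qed (use Suc in simp)
qed

lemma Ck_on_bilinear:
  assumes "open S" "bounded_bilinear B" "Ck_on k S f" "Ck_on k S g"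
  shows "Ck_on k S (\<lambda>x. B (f x) (g x))"
  using assms(3,4)
proof (induction k arbitrary: f g)
  case 0
  then show ?case using bounded_bilinear.continuous_on[OF assms(2)] by auto
next
  case (Suc k)
  show ?case
  proof (rule Ck_on_SucI[OF assms(1)])
    show "((\<lambda>x. B (f x) (g x)) has_derivative
        (\<lambda>v. B (f x) (frechet_derivative g (at x) v) + B (frechet_derivative f (at x) v) (g x))) (at x)"
      if "x \<in> S" for x
      using Suc.prems that
      by (intro bounded_bilinear.FDERIV[OF assms(2)]) (auto intro: Ck_on_has_derivative)
    show "Ck_on k S (\<lambda>x. B (f x) (frechet_derivative g (at x) v)
        + B (frechet_derivative f (at x) v) (g x))" for v
      by (intro Ck_on_add assms(1) Suc.IH) (use Suc.prems Ck_on_SucD in auto)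
  qed
qed

lemma smooth_on_has_derivative:
  "smooth_on S f \<Longrightarrow> x \<in> S \<Longrightarrow> (f has_derivative frechet_derivative f (at x)) (at x)"
  unfolding smooth_on_def by (blast intro: Ck_on_has_derivative)

lemma smooth_on_continuous: "smooth_on S f \<Longrightarrow> continuous_on S f"
  by (metis Ck_on.simps(1) smooth_on_def)

lemma smooth_on_frechet_derivative:
  "smooth_on S f \<Longrightarrow> smooth_on S (\<lambda>x. frechet_derivative f (at x) v)"
  unfolding smooth_on_def by (metis Ck_on.simps(2))

lemma smooth_on_subset: "smooth_on S f \<Longrightarrow> T \<subseteq> S \<Longrightarrow> smooth_on T f"
  unfolding smooth_on_def by (blast intro: Ck_on_subset)

lemma smooth_on_const: "open S \<Longrightarrow> smooth_on S (\<lambda>x. c)"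
  by (simp add: smooth_on_def Ck_on_const)

lemma smooth_on_linear:
  "open S \<Longrightarrow> bounded_linear L \<Longrightarrow> smooth_on S f \<Longrightarrow> smooth_on S (\<lambda>x. L (f x))"
  by (simp add: smooth_on_def Ck_on_linear)

lemma smooth_on_add:
  "open S \<Longrightarrow> smooth_on S f \<Longrightarrow> smooth_on S g \<Longrightarrow> smooth_on S (\<lambda>x. f x + g x)"
  by (simp add: smooth_on_def Ck_on_add)

lemma smooth_on_bilinear:
  "open S \<Longrightarrow> bounded_bilinear B \<Longrightarrow> smooth_on S f \<Longrightarrow> smooth_on S g
    \<Longrightarrow> smooth_on S (\<lambda>x. B (f x) (g x))"
  by (simp add: smooth_on_def Ck_on_bilinear)

lemma smooth_on_ident: "open S \<Longrightarrow> smooth_on S (\<lambda>x. x)"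
  unfolding smooth_on_def
proof
  fix k assume S: "open S"
  show "Ck_on k S (\<lambda>x. x)"
  proof (cases k)
    case (Suc l)
    show ?thesis unfolding Suc
      by (rule Ck_on_SucI[OF S, where f' = "\<lambda>x v. v"]) (simp_all add: S Ck_on_const)
  qed simp
qed

text \<open>The derivative is a product of three copies of the function itself and a linear
  function, so each order of differentiability yields the next.\<close>

lemma smooth_on_inverse_norm:
  "smooth_on (- {0}) (\<lambda>x :: 'a :: euclidean_space. inverse (norm x))"
  unfolding smooth_on_def
proof
  fix k
  let ?S = "- {0} :: 'a set"
  have S: "open ?S" by (simp add: open_Compl)
  show "Ck_on k ?S (\<lambda>x. inverse (norm x))"
  proof (induction k)
    case 0
    show ?case by (auto intro!: continuous_intros)
  next
    case (Suc k)
    have mult: "Ck_on k ?S (\<lambda>x. f x * g x)" if "Ck_on k ?S f" "Ck_on k ?S g" for f g :: "'a \<Rightarrow> real"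
      using that by (intro Ck_on_bilinear[OF S bounded_bilinear_mult])
    show ?case
    proof (rule Ck_on_SucI[OF S])
      show "((\<lambda>x. inverse (norm x)) has_derivative
          (\<lambda>v. (inverse (norm x) * inverse (norm x) * inverse (norm x)) * (x \<bullet> (- v)))) (at x)"
        if "x \<in> ?S" for x
        using that
        by (auto intro!: derivative_eq_intros has_derivative_norm
            simp: fun_eq_iff sgn_div_norm field_simps inner_commute)
      have "Ck_on k ?S (\<lambda>x. x \<bullet> (- v))" for v
        using smooth_on_ident[OF S] Ck_on_linear[OF S bounded_linear_inner_left]
        unfolding smooth_on_def by blast
      then show "Ck_on k ?S (\<lambda>x. (inverse (norm x) * inverse (norm x) * inverse (norm x)) * (x \<bullet> (- v)))" for v
        by (intro mult Suc.IH)
    qed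
  qed
qed

section \<open>Connections preserving the almost complex structure\<close>

lemma smooth_on_normalize: "smooth_on (- {0}) (\<lambda>y :: imO. y /\<^sub>R norm y)"
  by (rule smooth_on_bilinear[OF _ bounded_bilinear_scaleR smooth_on_inverse_norm smooth_on_ident])
    (simp_all add: open_Compl)

lemma smooth_S6_linear: "bounded_linear L \<Longrightarrow> smooth_S6 L"
  unfolding smooth_S6_def
  by (rule smooth_on_linear[OF _ _ smooth_on_normalize]) (simp_all add: open_Compl)

lemma smooth_S6_const: "smooth_S6 (\<lambda>y. c)"
  unfolding smooth_S6_def by (rule smooth_on_const) (simp add: open_Compl)

lemma smooth_S6_add: "smooth_S6 f \<Longrightarrow> smooth_S6 g \<Longrightarrow> smooth_S6 (\<lambda>y. f y + g y)"
  unfolding smooth_S6_def by (rule smooth_on_add) (simp_all add: open_Compl)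

lemma smooth_S6_bilinear:
  "bounded_bilinear B \<Longrightarrow> smooth_S6 f \<Longrightarrow> smooth_S6 g \<Longrightarrow> smooth_S6 (\<lambda>y. B (f y) (g y))"
  unfolding smooth_S6_def by (rule smooth_on_bilinear) (simp_all add: open_Compl)

lemma proj_tan_tangent: "x \<in> S6 \<Longrightarrow> proj_tan x v \<in> tangent_S6 x"
  by (simp add: proj_tan_def tangent_S6_def inner_diff_left norm_eq_1)

lemma proj_tan_id: "v \<in> tangent_S6 x \<Longrightarrow> proj_tan x v = v"
  by (simp add: proj_tan_def tangent_S6_def)

lemma linear_proj_tan: "linear (proj_tan x)"
  by (rule linearI) (simp_all add: proj_tan_def inner_add_left algebra_simps)

text \<open>The seven projected coordinate fields span every tangent space. They replace a frame in
  all computations with connections.\<close>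

lemma proj_tan_sum: "proj_tan x w = (\<Sum>k\<in>UNIV. w $ k *\<^sub>R proj_tan x (axis k 1))"
proof -
  have "proj_tan x w = proj_tan x (\<Sum>k\<in>UNIV. w $ k *\<^sub>R axis k 1)"
    using basis_expansion[of w] by (simp add: scalar_mult_eq_scaleR)
  then show ?thesis
    by (simp add: linear_sum[OF linear_proj_tan] linear_scale[OF linear_proj_tan])
qed

lemma vector_field_proj_tan:
  assumes "smooth_S6 X" shows "vector_field (\<lambda>y. proj_tan y (X y))"
proof -
  have id: "smooth_S6 (\<lambda>y. y)" by (rule smooth_S6_linear[OF bounded_linear_ident])
  note neg = bounded_bilinear.comp1[OF bounded_bilinear_scaleR bounded_linear_minus[OF bounded_linear_ident]]
  have "smooth_S6 (\<lambda>y. (- (X y \<bullet> y)) *\<^sub>R y)"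
    by (rule smooth_S6_bilinear[OF neg smooth_S6_bilinear[OF bounded_bilinear_inner assms id] id])
  from smooth_S6_add[OF assms this] show ?thesis
    unfolding vector_field_def using proj_tan_tangent by (simp add: proj_tan_def)
qed

lemma vector_field_add: "vector_field X \<Longrightarrow> vector_field Y \<Longrightarrow> vector_field (\<lambda>y. X y + Y y)"
  unfolding vector_field_def by (auto intro: smooth_S6_add simp: tangent_S6_def inner_add_left)

lemma vector_field_scale: "smooth_S6 f \<Longrightarrow> vector_field X \<Longrightarrow> vector_field (\<lambda>y. f y *\<^sub>R X y)"
  unfolding vector_field_def
  by (auto intro: smooth_S6_bilinear[OF bounded_bilinear_scaleR] simp: tangent_S6_def)

lemma vector_field_zero: "vector_field (\<lambda>y. 0)"
  by (simp add: vector_field_def smooth_S6_const tangent_S6_def)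

text \<open>At a point of the sphere the derivative of the radial retraction is the tangential
  projection, which fixes \<open>v\<close>.\<close>

lemma dS6_eq:
  assumes "(f has_derivative f') (at x)" and "x \<in> S6" and "v \<in> tangent_S6 x"
  shows "dS6 f x v = f' v"
proof -
  have x: "norm x = 1" "x \<noteq> 0" using assms(2) by auto
  have "((\<lambda>y. y /\<^sub>R norm y) has_derivative (\<lambda>w. w - (w \<bullet> x) *\<^sub>R x)) (at x)"
    using x by (auto intro!: derivative_eq_intros has_derivative_norm
        simp: fun_eq_iff sgn_div_norm algebra_simps inner_commute)
  then have "((\<lambda>y. f (y /\<^sub>R norm y)) has_derivative (\<lambda>w. f' (w - (w \<bullet> x) *\<^sub>R x))) (at x)"
    using has_derivative_compose[of _ _ x UNIV f f'] assms(1) x by simp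
  from frechet_derivative_at[OF this, symmetric] show ?thesis
    using assms(3) by (simp add: dS6_def tangent_S6_def)
qed

lemma dS6_linear:
  "bounded_linear L \<Longrightarrow> x \<in> S6 \<Longrightarrow> v \<in> tangent_S6 x \<Longrightarrow> dS6 L x v = L v"
  by (rule dS6_eq[OF bounded_linear_imp_has_derivative])

lemma dS6_const: "dS6 (\<lambda>y. c) x v = 0"
  by (simp add: dS6_def)

text \<open>At \<open>x\<close>, the derivative of the projected field of \<open>w\<close> in
  direction \<open>v\<close> is a multiple of \<open>x\<close> that is symmetric in \<open>v\<close>
  and \<open>w\<close>.\<close>

lemma lie_bracket_proj_tan:
  assumes "x \<in> S6" "v \<in> tangent_S6 x" "w \<in> tangent_S6 x"
  shows "lie_bracket (\<lambda>y. proj_tan y v) (\<lambda>y. proj_tan y w) x = 0"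
proof -
  have "dS6 (\<lambda>y. proj_tan y w) x v = - (w \<bullet> v) *\<^sub>R x" if "v \<in> tangent_S6 x" "w \<in> tangent_S6 x" for v w
  proof -
    have "((\<lambda>y. proj_tan y w) has_derivative (\<lambda>t. - ((w \<bullet> t) *\<^sub>R x + (w \<bullet> x) *\<^sub>R t))) (at x)"
      unfolding proj_tan_def by (auto intro!: derivative_eq_intros simp: fun_eq_iff)
    from dS6_eq[OF this assms(1) that(1)] show ?thesis
      using that(2) by (simp add: tangent_S6_def)
  qed
  then show ?thesis
    using assms by (simp add: lie_bracket_def proj_tan_id inner_commute)
qed

lemma connection_sum:
  assumes "connection_S6 nabla" and "x \<in> S6" and "v \<in> tangent_S6 x"
    and "finite K" and c: "\<And>k. smooth_S6 (c k)" and E: "\<And>k. vector_field (E k)"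
  shows "nabla (\<lambda>y. \<Sum>k\<in>K. c k y *\<^sub>R E k y) x v
    = (\<Sum>k\<in>K. dS6 (c k) x v *\<^sub>R E k x + c k x *\<^sub>R nabla (E k) x v)"
proof -
  have leibniz: "nabla (\<lambda>y. f y *\<^sub>R X y) x v = dS6 f x v *\<^sub>R X x + f x *\<^sub>R nabla X x v"
    if "smooth_S6 f" "vector_field X" for f X
    using assms(1-3) that unfolding connection_S6_def by blast
  have add: "nabla (\<lambda>y. X y + Y y) x v = nabla X x v + nabla Y x v"
    if "vector_field X" "vector_field Y" for X Y
    using assms(1-3) that unfolding connection_S6_def by blast
  \<comment> \<open>Additivity of \<open>nabla\<close> is available for vector fields only, so the
    induction carries this property of the partial sums along.\<close>
  from assms(4) have "vector_field (\<lambda>y. \<Sum>k\<in>K. c k y *\<^sub>R E k y) \<and> ?thesis"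
  proof induction
    case empty
    show ?case
      using leibniz[OF smooth_S6_const[of 0] vector_field_zero]
      by (simp add: dS6_const vector_field_zero)
  next
    case (insert k K)
    then show ?case
      by (simp add: add vector_field_add vector_field_scale leibniz c E)
  qed
  then show ?thesis ..
qed

text \<open>Expand in the seven fields: freezing the coefficients at \<open>x\<close> loses exactly
  their derivatives in the Leibniz rule.\<close>

lemma connection_proj_tan:
  assumes "connection_S6 nabla" and "x \<in> S6" and "v \<in> tangent_S6 x" and L: "bounded_linear L"
  shows "nabla (\<lambda>y. proj_tan y (L y)) x v = proj_tan x (L v) + nabla (\<lambda>y. proj_tan y (L x)) x v"
proof -
  let ?E = "\<lambda>k y. proj_tan y (axis k 1 :: imO)"
  have lin: "bounded_linear (\<lambda>y. L y $ k)" for k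
    using bounded_linear_compose[OF bounded_linear_vec_nth L] .
  note sum = connection_sum[where E = ?E, OF assms(1-3) finite_class.finite_UNIV _
      vector_field_proj_tan[OF smooth_S6_const]]
  have "nabla (\<lambda>y. proj_tan y (L y)) x v = nabla (\<lambda>y. \<Sum>k\<in>UNIV. L y $ k *\<^sub>R ?E k y) x v"
    by (simp only: proj_tan_sum[symmetric])
  also have "\<dots> = (\<Sum>k\<in>UNIV. L v $ k *\<^sub>R ?E k x + L x $ k *\<^sub>R nabla (?E k) x v)"
    using sum[of "\<lambda>k y. L y $ k", OF smooth_S6_linear[OF lin]] dS6_linear[OF lin assms(2,3)]
    by simp
  also have "\<dots> = proj_tan x (L v) + (\<Sum>k\<in>UNIV. L x $ k *\<^sub>R nabla (?E k) x v)"
    by (simp only: sum.distrib proj_tan_sum[symmetric])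
  also have "(\<Sum>k\<in>UNIV. L x $ k *\<^sub>R nabla (?E k) x v)
      = nabla (\<lambda>y. \<Sum>k\<in>UNIV. L x $ k *\<^sub>R ?E k y) x v"
    using sum[of "\<lambda>k y. L x $ k", OF smooth_S6_const] by (simp add: dS6_const)
  also have "\<dots> = nabla (\<lambda>y. proj_tan y (L x)) x v"
    by (simp only: proj_tan_sum[symmetric])
  finally show ?thesis .
qed

lemma connection_tangent:
  assumes "connection_S6 nabla" "x \<in> S6" "v \<in> tangent_S6 x" "vector_field X"
  shows "nabla X x v \<in> tangent_S6 x"
  using assms unfolding connection_S6_def by blast

text \<open>Applying \<open>J0\<close> to the projected field of \<open>w\<close> gives the
  projection of the linear function \<open>\<lambda>y. cross7 y w\<close>. Freezing this function at
  \<open>x\<close> produces the correction term, the derivative of \<open>J0\<close>.\<close>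

lemma J0_connection_proj_tan:
  assumes "J0_connection nabla" and "x \<in> S6" and "v \<in> tangent_S6 x"
  shows "nabla (\<lambda>y. proj_tan y (J0 x w)) x v
    = J0 x (nabla (\<lambda>y. proj_tan y w) x v) - proj_tan x (cross7 v w)"
proof -
  have L: "bounded_linear (\<lambda>y. cross7 y w)" by (rule cross7.bounded_linear_left)
  have eq: "J0 y (proj_tan y w) = proj_tan y (cross7 y w)" for y
    by (simp add: J0_def proj_tan_def cross7.diff_right cross7.scaleR_right)
  have "nabla (\<lambda>y. J0 y (proj_tan y w)) x v = J0 x (nabla (\<lambda>y. proj_tan y w) x v)"
    using assms vector_field_proj_tan[OF smooth_S6_const[of w]]
    unfolding J0_connection_def by blast
  then have "J0 x (nabla (\<lambda>y. proj_tan y w) x v) = nabla (\<lambda>y. proj_tan y (cross7 y w)) x v"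
    by (simp only: eq)
  with connection_proj_tan[OF _ assms(2,3) L, of nabla] assms(1) show ?thesis
    by (simp add: J0_connection_def J0_def)
qed

lemma J0_J0: "x \<in> S6 \<Longrightarrow> v \<in> tangent_S6 x \<Longrightarrow> J0 x (J0 x v) = - v"
  by (simp add: J0_def cross7_cross7 tangent_S6_def inner_commute norm_eq_1)

lemma J0_tangent: "J0 x v \<in> tangent_S6 x"
  by (simp add: J0_def tangent_S6_def)

lemma J0_proj_tan: "J0 x (proj_tan x v) = J0 x v"
  by (simp add: J0_def proj_tan_def cross7.diff_right cross7.scaleR_right)

section \<open>The differential of a pseudoholomorphic map and its linearized operator\<close>

context
  fixes u
  assumes u: "pseudoholomorphic u"
begin

lemma pseudoholomorphic_S6: "u p \<in> S6"
  using u unfolding pseudoholomorphic_def by blast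

lemma pseudoholomorphic_has_derivative:
  "((\<lambda>w. u (pt b w)) has_derivative du u b z) (at z)"
  using u smooth_on_has_derivative[of UNIV "\<lambda>w. u (pt b w)" z]
  unfolding pseudoholomorphic_def du_def by auto

lemma linear_du: "linear (du u b z)"
  using pseudoholomorphic_has_derivative has_derivative_linear by blast

lemma du_tangent: "du u b z Y \<in> tangent_S6 (u (pt b z))"
proof -
  have "((\<lambda>w. u (pt b w) \<bullet> u (pt b w)) has_derivative
      (\<lambda>Y. u (pt b z) \<bullet> du u b z Y + du u b z Y \<bullet> u (pt b z))) (at z)"
    by (intro has_derivative_inner pseudoholomorphic_has_derivative)
  moreover have "u (pt b w) \<bullet> u (pt b w) = 1" for w
    using pseudoholomorphic_S6[of "pt b w"] by (simp add: norm_eq_1)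
  ultimately have "((\<lambda>w. 1) has_derivative
      (\<lambda>Y. u (pt b z) \<bullet> du u b z Y + du u b z Y \<bullet> u (pt b z))) (at z)"
    by simp
  from fun_cong[OF has_derivative_unique[OF this has_derivative_const], of Y]
  show ?thesis
    by (simp add: tangent_S6_def inner_commute)
qed

lemma du_i: "du u b z (\<i> * Y) = J0 (u (pt b z)) (du u b z Y)"
proof -
  let ?x = "u (pt b z)"
  have "du u b z Y = - J0 ?x (du u b z (\<i> * Y))"
    using u by (simp add: pseudoholomorphic_def dbar_J0_def eq_neg_iff_add_eq_0)
  then have "J0 ?x (du u b z Y) = - J0 ?x (J0 ?x (du u b z (\<i> * Y)))"
    by (simp only: J0_def cross7.minus_right)
  also have "\<dots> = du u b z (\<i> * Y)"
    using J0_J0[OF pseudoholomorphic_S6 du_tangent] by simp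
  finally show ?thesis ..
qed

text \<open>In the torsion terms all contributions of the connection cancel, except for the failure
  of the Levi-Civita connection to preserve the almost complex structure.\<close>

lemma lin_op_eq:
  assumes "J0_connection nabla" and "\<xi> (pt b z) \<in> tangent_S6 (u (pt b z))"
  shows "lin_op nabla u \<xi> b z Y =
    (1/2) *\<^sub>R (proj_tan (u (pt b z)) (frechet_derivative (\<lambda>w. \<xi> (pt b w)) (at z) Y)
      + J0 (u (pt b z)) (frechet_derivative (\<lambda>w. \<xi> (pt b w)) (at z) (\<i> * Y))
      - J0 (u (pt b z)) (cross7 (\<xi> (pt b z)) (du u b z Y)))"
proof -
  define x where "x = u (pt b z)"
  define v where "v = \<xi> (pt b z)"
  define U where "U = du u b z Y"
  define N where "N w t = nabla (\<lambda>y. proj_tan y w) x t" for w t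
  note defs = x_def[symmetric] v_def[symmetric] U_def[symmetric] N_def[symmetric]
  have x: "x \<in> S6" using pseudoholomorphic_S6 x_def by simp
  have v: "v \<in> tangent_S6 x" and U: "U \<in> tangent_S6 x"
    using assms(2) du_tangent x_def v_def U_def by auto
  have tors: "torsion nabla x v w = N w v - N v w" if "w \<in> tangent_S6 x" for w
    using lie_bracket_proj_tan[OF x v that] by (simp add: torsion_def N_def)
  have N: "N U v \<in> tangent_S6 x"
    unfolding N_def using assms(1) connection_tangent[OF _ x v vector_field_proj_tan[OF smooth_S6_const]]
    by (simp add: J0_connection_def)
  \<comment> \<open>The terms \<open>N v U\<close> and \<open>N v (J0 x U)\<close> of the pulled
    back connection cancel against the torsion. What is left is
    \<open>N U v + J0 x (N (J0 x U) v)\<close>, evaluated here.\<close>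
  have "J0 x (N (J0 x U) v) = J0 x (J0 x (N U v)) - J0 x (cross7 v U)"
    using J0_connection_proj_tan[OF assms(1) x v, of U] J0_proj_tan[of x "cross7 v U"]
    by (simp add: N_def[symmetric] J0_def cross7.diff_right)
  also have "\<dots> = - N U v - J0 x (cross7 v U)"
    by (simp only: J0_J0[OF x N])
  finally have NJ: "J0 x (N (J0 x U) v) = - N U v - J0 x (cross7 v U)" .
  show ?thesis
    unfolding lin_op_def pullback_conn_def Let_def du_i defs
    unfolding tors[OF U] tors[OF J0_tangent]
    using NJ J0_proj_tan[of x]
    by (simp add: J0_def cross7.add_right cross7.diff_right scaleR_add_right[symmetric] del: scaleR_add_right)
qed

end

section \<open>Associative subspaces\<close>

text \<open>For orthonormal \<open>a\<close> and \<open>b\<close> this is the orthogonal projection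
  onto a copy of the imaginary quaternions.\<close>

definition assoc_proj :: "imO \<Rightarrow> imO \<Rightarrow> imO \<Rightarrow> imO" where
  "assoc_proj a b w = (w \<bullet> a) *\<^sub>R a + (w \<bullet> b) *\<^sub>R b + (w \<bullet> cross7 a b) *\<^sub>R cross7 a b"

locale associative_frame =
  fixes a b :: imO
  assumes orthonormal: "a \<bullet> a = 1" "b \<bullet> b = 1" "a \<bullet> b = 0"
begin

abbreviation "ab \<equiv> cross7 a b"

abbreviation "Q \<equiv> assoc_proj a b"

lemma frame_inner [simp]: "a \<bullet> a = 1" "b \<bullet> b = 1" "a \<bullet> b = 0" "b \<bullet> a = 0" "ab \<bullet> ab = 1"
  using orthonormal norm_cross7[of a b] by (simp_all add: power2_norm_eq_inner inner_commute)

lemma frame_cross [simp]: "cross7 a ab = - b" "cross7 ab a = b" "cross7 b ab = a" "cross7 ab b = - a"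
proof -
  show 1: "cross7 a ab = - b" by (simp add: cross7_cross7)
  show 2: "cross7 b ab = a"
    using cross7_cross7[of b a] cross7_skew[of a b] by (simp add: cross7.minus_right)
  show "cross7 ab a = b" "cross7 ab b = - a"
    using 1 2 cross7_skew[of ab a] cross7_skew[of ab b] by simp_all
qed

lemma bounded_linear_Q: "bounded_linear Q"
  unfolding linear_conv_bounded_linear[symmetric]
  by (rule linearI) (simp_all add: assoc_proj_def inner_add_left algebra_simps)

lemma Q_inner: "Q v \<bullet> w = v \<bullet> Q w"
  by (simp add: assoc_proj_def inner_add_left inner_add_right inner_commute)

lemma Q_idem [simp]: "Q (Q w) = Q w"
  by (simp add: assoc_proj_def inner_add_left)

lemma Q_frame [simp]: "Q a = a" "Q b = b" "Q ab = ab"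
  by (simp_all add: assoc_proj_def)

text \<open>The associative subspace is closed under the product, and by skew-adjointness its
  complement is preserved too. It suffices to check this for the three frame vectors.\<close>

lemma Q_cross7:
  assumes "Q x = x" shows "Q (cross7 x w) = cross7 x (Q w)"
proof -
  interpret Q: bounded_linear Q by (rule bounded_linear_Q)
  have "Q (cross7 a w) = cross7 a (Q w)" "Q (cross7 b w) = cross7 b (Q w)"
      "Q (cross7 ab w) = cross7 ab (Q w)"
    using inner_cross7_right[of w a b] inner_cross7_right[of w b a] inner_cross7_right[of w a ab]
      inner_cross7_right[of w b ab] inner_cross7_right[of w ab a] inner_cross7_right[of w ab b]
      cross7_skew[of b a]
    by (simp_all add: assoc_proj_def cross7.add_right cross7.diff_right cross7.scaleR_right inner_commute)
  then have "Q (cross7 (Q x) w) = cross7 (Q x) (Q w)"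
    unfolding assoc_proj_def[of a b x]
    by (simp only: cross7.add_left cross7.scaleR_left Q.add Q.scaleR)
  with assms show ?thesis by simp
qed

end

text \<open>The vectors combined with \<open>f\<close>, \<open>e\<close>, \<open>c\<close> are their
  derivatives. Their coefficients \<open>r\<close>, \<open>s\<close>, \<open>t\<close> form a
  skew-symmetric matrix, which makes the terms cancel in pairs.\<close>

lemma antisymmetric_frame_algebra:
  fixes f e c :: "'a :: real_inner"
  shows "(w \<bullet> (s *\<^sub>R e + t *\<^sub>R c)) *\<^sub>R f + (w \<bullet> f) *\<^sub>R (s *\<^sub>R e + t *\<^sub>R c)
   + ((w \<bullet> (r *\<^sub>R c - s *\<^sub>R f)) *\<^sub>R e + (w \<bullet> e) *\<^sub>R (r *\<^sub>R c - s *\<^sub>R f))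
   + ((w \<bullet> (- (t *\<^sub>R f) - r *\<^sub>R e)) *\<^sub>R c + (w \<bullet> c) *\<^sub>R (- (t *\<^sub>R f) - r *\<^sub>R e)) = 0"
  by (simp add: inner_add_right inner_diff_right algebra_simps)

text \<open>The connection form of an orthonormal frame is skew-symmetric, so if the derivatives of the
  frame stay in its span, the projection onto the span has derivative zero.\<close>

lemma assoc_proj_constant:
  fixes f e :: "'a :: real_normed_vector \<Rightarrow> imO"
  assumes f: "\<And>z. (f has_derivative f' z) (at z)" and e: "\<And>z. (e has_derivative e' z) (at z)"
    and frame: "\<And>z. associative_frame (f z) (e z)"
    and Qf: "\<And>z Y. assoc_proj (f z) (e z) (f' z Y) = f' z Y"
    and Qe: "\<And>z Y. assoc_proj (f z) (e z) (e' z Y) = e' z Y"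
  shows "assoc_proj (f z) (e z) w = assoc_proj (f z') (e z') w"
proof -
  define c where "c z = cross7 (f z) (e z)" for z
  define c' where "c' z Y = cross7 (f z) (e' z Y) + cross7 (f' z Y) (e z)" for z Y
  have c: "(c has_derivative c' z) (at z)" for z
    unfolding c_def[abs_def] c'_def[abs_def] by (rule cross7.FDERIV[OF f e])
  have zero: "(w \<bullet> f' z Y) *\<^sub>R f z + (w \<bullet> f z) *\<^sub>R f' z Y
      + ((w \<bullet> e' z Y) *\<^sub>R e z + (w \<bullet> e z) *\<^sub>R e' z Y)
      + ((w \<bullet> c' z Y) *\<^sub>R c z + (w \<bullet> c z) *\<^sub>R c' z Y) = 0" for z Y
  proof -
    interpret associative_frame "f z" "e z" by (rule frame)
    have const: "k z \<bullet> l' z Y + k' z Y \<bullet> l z = 0"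
      if "\<And>z. (k has_derivative k' z) (at z)" "\<And>z. (l has_derivative l' z) (at z)"
        "\<And>z. k z \<bullet> l z = r" for k l :: "'a \<Rightarrow> imO" and k' l' r
    proof -
      have "((\<lambda>z. k z \<bullet> l z) has_derivative (\<lambda>Y. k z \<bullet> l' z Y + k' z Y \<bullet> l z)) (at z)"
        by (intro has_derivative_inner that)
      then have "((\<lambda>z. r) has_derivative (\<lambda>Y. k z \<bullet> l' z Y + k' z Y \<bullet> l z)) (at z)"
        by (simp add: that(3))
      from fun_cong[OF has_derivative_unique[OF this has_derivative_const], of Y] show ?thesis .
    qed
    have ff: "f' z Y \<bullet> f z = 0"
      using const[OF f f] associative_frame.orthonormal(1)[OF frame] by (simp add: inner_commute)
    have ee: "e' z Y \<bullet> e z = 0"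
      using const[OF e e] associative_frame.orthonormal(2)[OF frame] by (simp add: inner_commute)
    have fe: "e' z Y \<bullet> f z = - (f' z Y \<bullet> e z)"
      using const[OF f e] associative_frame.orthonormal(3)[OF frame] by (simp add: inner_commute)
    define s where "s = f' z Y \<bullet> e z"
    define t where "t = f' z Y \<bullet> c z"
    define r where "r = e' z Y \<bullet> c z"
    have 1: "f' z Y = s *\<^sub>R e z + t *\<^sub>R c z"
      using Qf[of z Y] ff by (simp add: assoc_proj_def s_def t_def c_def)
    have 2: "e' z Y = r *\<^sub>R c z - s *\<^sub>R f z"
      using Qe[of z Y] ee fe by (simp add: assoc_proj_def s_def r_def c_def)
    \<comment> \<open>No separate assumption on the third vector: the product rule and the
      multiplication table of the frame determine its derivative.\<close>
    have 3: "c' z Y = - (t *\<^sub>R f z) - r *\<^sub>R e z"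
      unfolding c'_def 1 2
      by (simp add: c_def cross7.add_left cross7.diff_right cross7.scaleR_left cross7.scaleR_right)
    show ?thesis
      unfolding 1 2 3 by (rule antisymmetric_frame_algebra)
  qed
  have "((\<lambda>z. assoc_proj (f z) (e z) w) has_derivative (\<lambda>Y. 0)) (at z)" for z
  proof -
    have *: "((\<lambda>z. (w \<bullet> k z) *\<^sub>R k z) has_derivative
        (\<lambda>Y. (w \<bullet> k z) *\<^sub>R k' z Y + (w \<bullet> k' z Y) *\<^sub>R k z)) (at z)"
      if "\<And>z. (k has_derivative k' z) (at z)" for k k'
      by (intro has_derivative_scaleR has_derivative_inner_right that)
    have "((\<lambda>z. (w \<bullet> f z) *\<^sub>R f z + (w \<bullet> e z) *\<^sub>R e z + (w \<bullet> c z) *\<^sub>R c z) has_derivative (\<lambda>Y. 0)) (at z)"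
      by (rule has_derivative_eq_rhs[OF has_derivative_add[OF has_derivative_add[OF *[OF f] *[OF e]] *[OF c]]])
        (use zero in \<open>simp add: fun_eq_iff algebra_simps\<close>)
    then show ?thesis by (simp add: assoc_proj_def[abs_def] c_def)
  qed
  then have "\<And>x. x \<in> UNIV \<Longrightarrow> ((\<lambda>z. assoc_proj (f z) (e z) w) has_derivative (\<lambda>Y. 0)) (at x within UNIV)"
    by simp
  from has_derivative_zero_unique[OF _ this, of z z'] show ?thesis
    by simp
qed

section \<open>Charts of the projective line\<close>

lemma pt_eq_iff: "pt b z = pt b' z' \<longleftrightarrow>
  {(c * fst (frame b z), c * snd (frame b z)) | c. True}
    = {(c * fst (frame b' z'), c * snd (frame b' z')) | c. True}"
proof -
  have "{(c * fst (frame b z), c * snd (frame b z)) | c. True} \<in>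
    {L. \<exists>v. v \<noteq> 0 \<and> L = {(c * fst v, c * snd v) | c. True}}" for b z
  proof -
    have "frame b z \<noteq> 0" by (cases b) (auto simp: zero_prod_def)
    then show ?thesis by blast
  qed
  then show ?thesis unfolding pt_def by (simp add: cp1_of_inject)
qed

lemma pt_eqD:
  assumes "pt b z = pt b' z'"
  shows "\<exists>c. frame b z = (c * fst (frame b' z'), c * snd (frame b' z'))"
proof -
  have "(1 * fst (frame b z), 1 * snd (frame b z)) \<in> {(c * fst (frame b z), c * snd (frame b z)) | c. True}"
    by blast
  then show ?thesis using assms unfolding pt_eq_iff by auto
qed

lemma inj_pt_Ch0: "pt Ch0 z = pt Ch0 z' \<Longrightarrow> z = z'"
  by (drule pt_eqD) auto

lemma pt_Ch1_eq_Ch0: "pt Ch1 z' = pt Ch0 z \<Longrightarrow> z' \<noteq> 0 \<and> z = 1 / z'"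
  by (drule pt_eqD) (auto simp: eq_divide_eq mult.commute)

section \<open>Totally geodesic pseudoholomorphic spheres\<close>

locale pseudoholomorphic_immersion =
  fixes u
  assumes ph: "pseudoholomorphic u" and imm: "immersed u"
begin

abbreviation "f \<equiv> \<lambda>z. u (pt Ch0 z)"

abbreviation "f' \<equiv> du u Ch0"

lemma f_norm [simp]: "f z \<bullet> f z = 1"
  using pseudoholomorphic_S6[OF ph, of "pt Ch0 z"] by (simp add: norm_eq_1)

lemma f'_i: "f' z (\<i> * Y) = cross7 (f z) (f' z Y)"
  using du_i[OF ph] by (simp add: J0_def)

lemma f'_tangent [simp]: "f' z Y \<bullet> f z = 0" "f z \<bullet> f' z Y = 0"
  using du_tangent[OF ph, of Ch0 z Y] by (simp_all add: tangent_S6_def inner_commute)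

lemma f'_eq_0_iff [simp]: "f' z Y = 0 \<longleftrightarrow> Y = 0"
  using imm linear_injective_0[OF linear_du[OF ph]] linear_0[OF linear_du[OF ph]]
  unfolding immersed_def by metis

lemma f'_eq: "f' z Y = Re Y *\<^sub>R f' z 1 + Im Y *\<^sub>R cross7 (f z) (f' z 1)"
proof -
  have "f' z Y = f' z (Re Y *\<^sub>R 1 + Im Y *\<^sub>R (\<i> * 1))"
    by (rule arg_cong[where f = "f' z"]) (simp add: complex_eq_iff)
  then show ?thesis
    by (simp only: linear_add[OF linear_du[OF ph]] linear_scale[OF linear_du[OF ph]] f'_i)
qed

text \<open>\<open>du_image\<close> collects vectors from both charts; the chain rule through the
  transition map brings those of \<open>Ch1\<close> back to \<open>Ch0\<close>.\<close>

lemma du_image_Ch0: "du_image u (pt Ch0 z) = range (f' z)"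
proof -
  have "du u Ch1 z' Y \<in> range (f' z)" if "pt Ch1 z' = pt Ch0 z" for z' Y
  proof -
    have z': "z' \<noteq> 0" and z: "z = 1 / z'" using pt_Ch1_eq_Ch0[OF that] by auto
    have "((\<lambda>w. 1 / w) has_derivative (\<lambda>Y. - Y / z'\<^sup>2)) (at z')"
      using z' by (auto intro!: derivative_eq_intros simp: power2_eq_square field_simps)
    then have "((\<lambda>w. f (1 / w)) has_derivative (\<lambda>Y. f' z (- Y / z'\<^sup>2))) (at z')"
      using has_derivative_compose[OF _ pseudoholomorphic_has_derivative[OF ph, of Ch0]]
      unfolding z by blast
    then have "((\<lambda>w. u (pt Ch1 w)) has_derivative (\<lambda>Y. f' z (- Y / z'\<^sup>2))) (at z')"
    proof (rule has_derivative_transform_within_open[of _ _ _ _ "- {0}"])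
      show "f (1 / w) = u (pt Ch1 w)" if "w \<in> - {0}" for w
        using pt_transition[of "1 / w"] that by simp
    qed (use z' in \<open>auto simp: open_Compl\<close>)
    from has_derivative_unique[OF pseudoholomorphic_has_derivative[OF ph, of Ch1] this]
    have "du u Ch1 z' Y = f' z (- Y / z'\<^sup>2)" by (rule fun_cong)
    then show ?thesis by simp
  qed
  moreover have "du u b z' Y \<in> range (f' z)" if "pt b z' = pt Ch0 z" "b = Ch0" for b z' Y
    using that inj_pt_Ch0 by auto
  ultimately have "du u b z' Y \<in> range (f' z)" if "pt b z' = pt Ch0 z" for b z' Y
    using that by (cases b) auto
  then show ?thesis unfolding du_image_def by blast
qed

text \<open>Since \<open>f' z \<i>\<close> is the product of \<open>f z\<close> and
  \<open>f' z 1\<close>, the associative subspace generated by \<open>f z\<close> and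
  \<open>e z\<close> is spanned by the position vector and the tangent plane.\<close>

definition e where "e z = f' z 1 /\<^sub>R norm (f' z 1)"

lemma frame_f_e: "associative_frame (f z) (e z)"
proof
  have "f' z 1 \<bullet> f' z 1 = norm (f' z 1) * norm (f' z 1)"
    by (simp add: dot_square_norm power2_eq_square)
  then show "e z \<bullet> e z = 1"
    by (simp add: e_def field_simps)
qed (simp_all add: e_def)

lemma assoc_proj_f': "assoc_proj (f z) (e z) (f' z Y) = f' z Y"
proof -
  interpret associative_frame "f z" "e z" by (rule frame_f_e)
  interpret Q: bounded_linear Q by (rule bounded_linear_Q)
  have 1: "f' z 1 = norm (f' z 1) *\<^sub>R e z" by (simp add: e_def)
  have "Q (f' z 1) = f' z 1" by (subst (2) 1, subst 1) (simp add: Q.scaleR)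
  then show ?thesis
    unfolding f'_eq[of z Y] by (simp add: Q.add Q.scaleR Q_cross7)
qed

end

locale totally_geodesic_sphere = pseudoholomorphic_immersion +
  assumes tg: "totally_geodesic u"
begin

text \<open>Total geodesy puts the tangential part of the second derivative into the tangent plane,
  and its radial part is a multiple of \<open>f z\<close>; normalizing adds only multiples of
  \<open>f' z 1\<close>.\<close>

lemma e_has_derivative:
  "\<exists>e'. (e has_derivative e') (at z) \<and> (\<forall>Y. assoc_proj (f z) (e z) (e' Y) = e' Y)"
proof -
  interpret associative_frame "f z" "e z" by (rule frame_f_e)
  interpret Q: bounded_linear Q by (rule bounded_linear_Q)
  define p where "p w = f' w 1" for w
  define p' where "p' = frechet_derivative p (at z)"
  have p: "(p has_derivative p') (at z)"
    using ph smooth_on_has_derivative[OF smooth_on_frechet_derivative, of UNIV f z 1]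
    unfolding p'_def p_def du_def pseudoholomorphic_def by auto
  have Qp': "Q (p' Y) = p' Y" for Y
  proof -
    \<comment> \<open>A vector lies in its own coset; as that is the zero coset, the vector is
      tangent to the curve.\<close>
    have "proj_tan (f z) (p' Y) \<in> nclass u (pt Ch0 z) (proj_tan (f z) (p' Y))"
      using linear_0[OF linear_du[OF ph]] rangeI[of "f' z" 0]
      unfolding nclass_def du_image_Ch0 by force
    also have "\<dots> = nclass u (pt Ch0 z) 0"
      using tg unfolding totally_geodesic_def second_ff_def nzero_def p'_def p_def by metis
    finally obtain Z where "proj_tan (f z) (p' Y) = f' z Z"
      unfolding nclass_def du_image_Ch0 by auto
    then have "p' Y = (p' Y \<bullet> f z) *\<^sub>R f z + f' z Z"
      by (simp add: proj_tan_def algebra_simps)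
    then show ?thesis
      using assoc_proj_f'[of z Z] by (metis Q.add Q.scaleR Q_frame(1))
  qed
  have "p z \<noteq> 0" by (simp add: p_def)
  then have "(e has_derivative (\<lambda>Y. (- (p' Y \<bullet> p z) / norm (p z) ^ 3) *\<^sub>R p z + p' Y /\<^sub>R norm (p z))) (at z)"
    unfolding e_def[abs_def] p_def[symmetric]
    by (auto intro!: derivative_eq_intros has_derivative_norm p has_derivative_compose[OF p has_derivative_norm]
        simp: fun_eq_iff sgn_div_norm divide_inverse power_inverse power3_eq_cube algebra_simps inner_commute)
  moreover have "Q ((- (p' Y \<bullet> p z) / norm (p z) ^ 3) *\<^sub>R p z + p' Y /\<^sub>R norm (p z))
      = (- (p' Y \<bullet> p z) / norm (p z) ^ 3) *\<^sub>R p z + p' Y /\<^sub>R norm (p z)" for Y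
    using assoc_proj_f'[of z 1] by (simp add: Q.diff Q.scaleR Qp' p_def)
  ultimately show ?thesis by blast
qed

lemma assoc_proj_f_e: "assoc_proj (f z) (e z) w = assoc_proj (f 0) (e 0) w"
proof -
  obtain e' where "(e has_derivative e' z) (at z)" "assoc_proj (f z) (e z) (e' z Y) = e' z Y" for z Y
    using e_has_derivative by metis
  then show ?thesis
    by (intro assoc_proj_constant[where f' = f' and e' = e'] frame_f_e assoc_proj_f'
        pseudoholomorphic_has_derivative[OF ph])
qed

end

text \<open>As the projection is the same at all points, the frame at \<open>0\<close> represents it
  from here on.\<close>

sublocale totally_geodesic_sphere \<subseteq> associative_frame "f 0" "e 0"
  by (rule frame_f_e)

context totally_geodesic_sphere
begin

lemma Q_f [simp]: "Q (f z) = f z"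
  using associative_frame.Q_frame(1)[OF frame_f_e] assoc_proj_f_e by metis

lemma Q_f' [simp]: "Q (f' z Y) = f' z Y"
  using assoc_proj_f' assoc_proj_f_e by metis

lemma du_image_eq: "du_image u (pt Ch0 z) = {v. Q v = v \<and> v \<bullet> f z = 0}"
proof (intro subset_antisym subsetI)
  fix v assume "v \<in> {v. Q v = v \<and> v \<bullet> f z = 0}"
  then have "v = (v \<bullet> e z) *\<^sub>R e z + (v \<bullet> cross7 (f z) (e z)) *\<^sub>R cross7 (f z) (e z)"
    using assoc_proj_f_e[of z v] by (simp add: assoc_proj_def)
  \<comment> \<open>The coordinates are rescaled because \<open>f' z\<close> is conformal with
    factor \<open>norm (f' z 1)\<close>.\<close>
  then have "v = f' z (Complex ((v \<bullet> e z) / norm (f' z 1)) ((v \<bullet> cross7 (f z) (e z)) / norm (f' z 1)))"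
    by (subst f'_eq) (simp add: e_def cross7.scaleR_right divide_inverse)
  then show "v \<in> du_image u (pt Ch0 z)" unfolding du_image_Ch0 by blast
qed (auto simp: du_image_Ch0)

end

section \<open>The normal bundle of a totally geodesic sphere\<close>

context associative_frame
begin

definition P :: "imO \<Rightarrow> imO" where "P w = w - Q w"

lemma bounded_linear_P: "bounded_linear P"
  unfolding P_def[abs_def] by (intro bounded_linear_sub bounded_linear_ident bounded_linear_Q)

sublocale Q: bounded_linear Q by (rule bounded_linear_Q)

sublocale P: bounded_linear P by (rule bounded_linear_P)

lemma Q_P [simp]: "Q (P w) = 0"
  by (simp add: P_def Q.diff)

lemma P_eq_iff: "P v = v \<longleftrightarrow> Q v = 0"
  by (simp add: P_def)

lemma P_eq_0_iff: "P v = 0 \<longleftrightarrow> Q v = v"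
  by (auto simp: P_def)

lemma P_cross7: "Q x = x \<Longrightarrow> P (cross7 x w) = cross7 x (P w)"
  by (simp add: P_def Q_cross7 cross7.diff_right)

lemma coassociative_orthogonal:
  assumes "Q x = x" "Q v = 0" shows "x \<bullet> v = 0" "v \<bullet> x = 0"
  using Q_inner[of x v] assms by (simp_all add: inner_commute)

lemma coassociative_cross7: "Q x = x \<Longrightarrow> Q v = 0 \<Longrightarrow> Q (cross7 x v) = 0"
  by (simp add: Q_cross7 cross7.zero_right)

lemma coassociative_square:
  "Q x = x \<Longrightarrow> Q v = 0 \<Longrightarrow> cross7 x (cross7 x v) = - ((x \<bullet> x) *\<^sub>R v)"
  by (simp add: cross7_cross7 coassociative_orthogonal)

lemma coassociative_anticommute:
  assumes "Q x = x" "Q y = y" "Q v = 0" "x \<bullet> y = 0"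
  shows "cross7 y (cross7 x v) = - cross7 x (cross7 y v)"
  using cross7_clifford[of x y v] assms
  by (simp add: coassociative_orthogonal add_eq_0_iff)

text \<open>This is the Clifford relation of \<open>x\<close> and \<open>v\<close> applied to
  \<open>y\<close>, with the factors then swapped. The sign reflects the failure of
  associativity.\<close>

lemma coassociative_assoc:
  assumes "Q x = x" "Q y = y" "Q v = 0" "x \<bullet> y = 0"
  shows "cross7 (cross7 x y) v = - cross7 x (cross7 y v)"
  using cross7_clifford[of x v y] assms cross7_skew[of v y] cross7_skew[of v "cross7 x y"]
  by (simp add: coassociative_orthogonal cross7.minus_right add_eq_0_iff)

end

section \<open>Fibres of the normal bundle as the kernel of \<open>Q\<close>\<close>

context totally_geodesic_sphere
begin

abbreviation cls :: "complex \<Rightarrow> imO \<Rightarrow> ncls" where "cls z \<equiv> nclass u (pt Ch0 z)"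

lemma cls_eq_iff: "cls z v = cls z v' \<longleftrightarrow> Q (v - v') = v - v' \<and> (v - v') \<bullet> f z = 0"
proof
  assume "cls z v = cls z v'"
  moreover have "v \<in> cls z v"
    unfolding nclass_def du_image_eq by (auto intro!: exI[of _ 0] simp: Q.zero)
  ultimately show "Q (v - v') = v - v' \<and> (v - v') \<bullet> f z = 0"
    unfolding nclass_def du_image_eq by auto
next
  assume *: "Q (v - v') = v - v' \<and> (v - v') \<bullet> f z = 0"
  have "x \<in> cls z v \<longleftrightarrow> x - v \<in> du_image u (pt Ch0 z)" for x v
    unfolding nclass_def by (force simp: algebra_simps)
  moreover have "x - v \<in> du_image u (pt Ch0 z) \<longleftrightarrow> x - v' \<in> du_image u (pt Ch0 z)" for x
  proof -
    have "x - v' = (x - v) + (v - v')" by simp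
    then show ?thesis
      using * by (metis (mono_tags, lifting) du_image_eq mem_Collect_eq Q.add Q.diff
          inner_add_left inner_diff_left add_diff_cancel diff_zero add.right_neutral)
  qed
  ultimately show "cls z v = cls z v'" by blast
qed

text \<open>\<open>P\<close> picks a canonical representative of each coset, so that identities of
  classes become identities of vectors.\<close>

lemma cls_eq_iff_P:
  "v \<bullet> f z = 0 \<Longrightarrow> v' \<bullet> f z = 0 \<Longrightarrow> cls z v = cls z v' \<longleftrightarrow> P v = P v'"
  unfolding cls_eq_iff by (simp add: P_eq_0_iff[symmetric] P.diff inner_diff_left)

lemma P_orthogonal [simp]: "P v \<bullet> f z = 0"
  by (rule coassociative_orthogonal) simp_all

lemma P_idem [simp]: "P (P v) = P v"
  by (simp add: P_eq_iff)

lemma cls_P: "v \<bullet> f z = 0 \<Longrightarrow> cls z (P v) = cls z v"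
  by (simp add: cls_eq_iff_P)

lemma cls_coassociative_eq_iff: "Q v = 0 \<Longrightarrow> Q w = 0 \<Longrightarrow> cls z v = cls z w \<longleftrightarrow> v = w"
  by (metis P_eq_iff P_orthogonal cls_eq_iff_P)

lemma nadd_cls: "nadd (cls z v) (cls z w) = cls z (v + w)"
proof (intro subset_antisym subsetI)
  fix x assume "x \<in> nadd (cls z v) (cls z w)"
  then obtain s t where "x = (v + s) + (w + t)" "Q s = s" "Q t = t" "s \<bullet> f z = 0" "t \<bullet> f z = 0"
    unfolding nadd_def nclass_def du_image_eq by blast
  then show "x \<in> cls z (v + w)"
    unfolding nclass_def du_image_eq
    by (auto intro!: exI[of _ "s + t"] simp: Q.add inner_add_left)
next
  fix x assume "x \<in> cls z (v + w)"
  then obtain t where "x = (v + 0) + (w + t)" "Q t = t" "t \<bullet> f z = 0"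
    unfolding nclass_def du_image_eq by auto
  moreover have "Q 0 = 0" "0 \<bullet> f z = 0" by (simp_all add: Q.zero)
  ultimately show "x \<in> nadd (cls z v) (cls z w)"
    unfolding nadd_def nclass_def du_image_eq by blast
qed

lemma nscale_cls:
  "nscale u (pt Ch0 z) c (cls z v) = cls z (Re c *\<^sub>R v + Im c *\<^sub>R cross7 (f z) v)"
proof (intro subset_antisym subsetI)
  fix x assume "x \<in> nscale u (pt Ch0 z) c (cls z v)"
  then obtain s t where x: "x = Re c *\<^sub>R (v + s) + Im c *\<^sub>R cross7 (f z) (v + s) + t"
    and st: "Q s = s" "Q t = t" "s \<bullet> f z = 0" "t \<bullet> f z = 0"
    unfolding nscale_def nclass_def du_image_eq J0_def by blast
  let ?t = "Re c *\<^sub>R s + Im c *\<^sub>R cross7 (f z) s + t"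
  have "x = Re c *\<^sub>R v + Im c *\<^sub>R cross7 (f z) v + ?t"
    by (simp add: x cross7.add_right algebra_simps)
  moreover have "Q ?t = ?t" "?t \<bullet> f z = 0"
    using st by (simp_all add: Q.add Q.scaleR Q_cross7 inner_add_left)
  ultimately show "x \<in> cls z (Re c *\<^sub>R v + Im c *\<^sub>R cross7 (f z) v)"
    unfolding nclass_def du_image_eq by blast
next
  fix x assume "x \<in> cls z (Re c *\<^sub>R v + Im c *\<^sub>R cross7 (f z) v)"
  then obtain t where "x = Re c *\<^sub>R (v + 0) + Im c *\<^sub>R cross7 (f z) (v + 0) + t" "Q t = t" "t \<bullet> f z = 0"
    unfolding nclass_def du_image_eq by auto
  moreover have "Q 0 = 0" "0 \<bullet> f z = 0" by (simp_all add: Q.zero)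
  ultimately show "x \<in> nscale u (pt Ch0 z) c (cls z v)"
    unfolding nscale_def nclass_def du_image_eq J0_def by blast
qed

lemma nfibre_eq: "nfibre u (pt Ch0 z) = cls z ` {v. Q v = 0}"
proof -
  have "tangent_S6 (f z) = {v. v \<bullet> f z = 0}" by (simp add: tangent_S6_def)
  moreover have "v \<bullet> f z = 0" if "Q v = 0" for v
    using coassociative_orthogonal that by simp
  ultimately show ?thesis
    unfolding nfibre_def using cls_P[of _ z] by (auto simp: image_iff) (metis Q_P)
qed

lemma nzero_eq: "nzero u (pt Ch0 z) = cls z 0"
  by (simp add: nzero_def)

section \<open>The anti-linear part of the normal operator\<close>

text \<open>The normal operator and its anti-linear part, on lifts with values in the kernel of \<open>Q\<close>.\<close>

definition nop :: "(complex \<Rightarrow> imO) \<Rightarrow> complex \<Rightarrow> complex \<Rightarrow> imO" where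
  "nop \<eta> z Y = (1/2) *\<^sub>R (frechet_derivative \<eta> (at z) Y
     + cross7 (f z) (frechet_derivative \<eta> (at z) (\<i> * Y)) + cross7 (f z) (cross7 (f' z Y) (\<eta> z)))"

definition B :: "complex \<Rightarrow> complex \<Rightarrow> imO \<Rightarrow> imO" where
  "B z Y v = cross7 (f z) (cross7 (f' z Y) v)"

lemma lift_has_derivative:
  assumes "lift_of u Ch0 V \<xi> s" "z \<in> V"
  shows "((\<lambda>w. \<xi> (pt Ch0 w)) has_derivative frechet_derivative (\<lambda>w. \<xi> (pt Ch0 w)) (at z)) (at z)"
  using assms smooth_on_has_derivative unfolding lift_of_def pullback_section_def by blast

lemma lift_orthogonal:
  "lift_of u Ch0 V \<xi> s \<Longrightarrow> z \<in> V \<Longrightarrow> \<xi> (pt Ch0 z) \<bullet> f z = 0"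
  unfolding lift_of_def pullback_section_def tangent_S6_def by blast

text \<open>\<open>P\<close> is one fixed linear map, so it passes through the derivative of the
  lift; it also commutes with products by \<open>f z\<close> and \<open>f' z Y\<close> and kills the
  radial part.\<close>

lemma cls_lin_op:
  assumes "J0_connection nabla" and lift: "lift_of u Ch0 V \<xi> s" "z \<in> V"
  shows "cls z (lin_op nabla u \<xi> Ch0 z Y) = cls z (nop (\<lambda>w. P (\<xi> (pt Ch0 w))) z Y)"
proof -
  define d where "d = frechet_derivative (\<lambda>w. \<xi> (pt Ch0 w)) (at z)"
  have "((\<lambda>w. P (\<xi> (pt Ch0 w))) has_derivative (\<lambda>Y. P (d Y))) (at z)"
    unfolding d_def by (rule P.has_derivative[OF lift_has_derivative[OF lift]])
  from frechet_derivative_at[OF this]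
  have dP: "frechet_derivative (\<lambda>w. P (\<xi> (pt Ch0 w))) (at z) = (\<lambda>Y. P (d Y))" ..
  have lin: "lin_op nabla u \<xi> Ch0 z Y = (1/2) *\<^sub>R (proj_tan (f z) (d Y) + cross7 (f z) (d (\<i> * Y))
      - cross7 (f z) (cross7 (\<xi> (pt Ch0 z)) (f' z Y)))"
    using lin_op_eq[OF ph assms(1), of \<xi> Ch0 z Y] lift_orthogonal[OF lift]
    by (simp add: d_def J0_def tangent_S6_def)
  have "P (proj_tan (f z) v) = P v" for v
    using P_eq_0_iff by (simp add: proj_tan_def P.diff P.scaleR)
  then have "P (lin_op nabla u \<xi> Ch0 z Y) = nop (\<lambda>w. P (\<xi> (pt Ch0 w))) z Y"
    unfolding lin nop_def dP cross7_skew[of "\<xi> (pt Ch0 z)"]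
    by (simp add: P.scaleR P.add P.diff P_cross7 cross7.minus_right)
  moreover have "lin_op nabla u \<xi> Ch0 z Y \<bullet> f z = 0"
    unfolding lin by (simp add: proj_tan_def inner_add_left inner_diff_left)
  ultimately show ?thesis
    using cls_P by metis
qed

text \<open>Two lifts of one section have the same image under \<open>P\<close> near
  \<open>z\<close>, hence the same derivative there; this makes the definite description
  meaningful.\<close>

lemma normal_op_eq:
  assumes nabla: "J0_connection nabla" and lift: "lift_of u Ch0 V \<xi> s" "z \<in> V"
  shows "normal_op nabla u s Ch0 z Y = cls z (nop (\<lambda>w. P (\<xi> (pt Ch0 w))) z Y)"
  unfolding normal_op_def
proof (rule the_equality, intro allI impI)
  fix \<xi>' V' assume "z \<in> V' \<and> lift_of u Ch0 V' \<xi>' s"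
  then have lift': "lift_of u Ch0 V' \<xi>' s" "z \<in> V'" by auto
  have "open V" "open V'" using lift(1) lift'(1) by (auto simp: lift_of_def pullback_section_def)
  then have VV': "open (V \<inter> V')" by blast
  have eq: "P (\<xi> (pt Ch0 w)) = P (\<xi>' (pt Ch0 w))" if "w \<in> V \<inter> V'" for w
  proof -
    have "cls w (\<xi> (pt Ch0 w)) = cls w (\<xi>' (pt Ch0 w))"
      using lift(1) lift'(1) that unfolding lift_of_def by auto
    then show ?thesis
      using cls_eq_iff_P lift_orthogonal[OF lift(1)] lift_orthogonal[OF lift'(1)] that by blast
  qed
  have "((\<lambda>w. P (\<xi> (pt Ch0 w))) has_derivative
      (\<lambda>Y. P (frechet_derivative (\<lambda>w. \<xi> (pt Ch0 w)) (at z) Y))) (at z)"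
    by (rule P.has_derivative[OF lift_has_derivative[OF lift]])
  then have "frechet_derivative (\<lambda>w. P (\<xi> (pt Ch0 w))) (at z)
      = frechet_derivative (\<lambda>w. P (\<xi>' (pt Ch0 w))) (at z)"
    using frechet_derivative_transform_within_open[of "\<lambda>w. P (\<xi> (pt Ch0 w))" z,
        OF _ VV' _ eq] lift(2) lift'(2)
    unfolding differentiable_def by blast
  then have "nop (\<lambda>w. P (\<xi> (pt Ch0 w))) z Y = nop (\<lambda>w. P (\<xi>' (pt Ch0 w))) z Y"
    using eq lift(2) lift'(2) by (simp add: nop_def)
  then show "cls z (nop (\<lambda>w. P (\<xi> (pt Ch0 w))) z Y) = cls z (lin_op nabla u \<xi>' Ch0 z Y)"
    using cls_lin_op[OF nabla lift'] by simp
next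
  fix m assume "\<forall>\<xi> V. z \<in> V \<and> lift_of u Ch0 V \<xi> s \<longrightarrow> m = cls z (lin_op nabla u \<xi> Ch0 z Y)"
  then show "m = cls z (nop (\<lambda>w. P (\<xi> (pt Ch0 w))) z Y)"
    using lift cls_lin_op[OF nabla lift] by blast
qed

lemma lift_nscale_i:
  assumes "lift_of u Ch0 V \<xi> s"
  shows "lift_of u Ch0 V (\<lambda>p. cross7 (u p) (\<xi> p)) (\<lambda>p. nscale u p \<i> (s p))"
proof -
  have "smooth_on V f"
    using ph smooth_on_subset unfolding pseudoholomorphic_def by blast
  then have "smooth_on V (\<lambda>w. cross7 (f w) (\<xi> (pt Ch0 w)))"
    using assms unfolding lift_of_def pullback_section_def
    by (intro smooth_on_bilinear[OF _ bounded_bilinear_cross7]) auto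
  then show ?thesis
    using assms unfolding lift_of_def pullback_section_def
    by (auto simp: tangent_S6_def nscale_cls)
qed

lemma antilinear_part_eq:
  assumes nabla: "J0_connection nabla" and lift: "lift_of u Ch0 V \<xi> s" "z \<in> V"
  shows "antilinear_part nabla u s Ch0 z Y = cls z (B z Y (P (\<xi> (pt Ch0 z))))"
proof -
  define \<eta> where "\<eta> w = P (\<xi> (pt Ch0 w))" for w
  define d where "d Y = P (frechet_derivative (\<lambda>w. \<xi> (pt Ch0 w)) (at z) Y)" for Y
  have \<eta>: "(\<eta> has_derivative d) (at z)"
    unfolding d_def[abs_def] \<eta>_def[abs_def] by (rule P.has_derivative[OF lift_has_derivative[OF lift]])
  note d\<eta> = frechet_derivative_at[OF \<eta>, symmetric]
  have "((\<lambda>w. cross7 (f w) (\<eta> w)) has_derivative (\<lambda>Y. cross7 (f z) (d Y) + cross7 (f' z Y) (\<eta> z))) (at z)"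
    by (rule cross7.FDERIV[OF pseudoholomorphic_has_derivative[OF ph] \<eta>])
  note dJ\<eta> = frechet_derivative_at[OF this, symmetric]
  have J\<eta>: "(\<lambda>w. P (cross7 (f w) (\<xi> (pt Ch0 w)))) = (\<lambda>w. cross7 (f w) (\<eta> w))"
    by (simp add: P_cross7 \<eta>_def)
  have Q: "Q (\<eta> z) = 0" "Q (d Y) = 0" for Y
    by (simp_all add: \<eta>_def d_def)
  let ?x = "f z" and ?U = "f' z Y"
  note rules = coassociative_square coassociative_cross7 Q
  have 1: "cross7 ?U (cross7 ?x (\<eta> z)) = - cross7 ?x (cross7 ?U (\<eta> z))"
    by (rule coassociative_anticommute) (simp_all add: Q)
  have 2: "cross7 (cross7 ?x ?U) (\<eta> z) = - cross7 ?x (cross7 ?U (\<eta> z))"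
    by (rule coassociative_assoc) (simp_all add: Q)
  define N where "N = nop (\<lambda>w. cross7 (f w) (\<eta> w)) z Y"
  have "cross7 ?x (B z Y (\<eta> z)) = - cross7 ?U (\<eta> z)"
    by (simp add: B_def rules)
  \<comment> \<open>The coefficient 3 has three sources: differentiating \<open>f\<close> along
    \<open>Y\<close>, differentiating it along \<open>\<i> * Y\<close>, and the zero-order term of
    \<open>nop\<close>.\<close>
  then have "N = (1/2) *\<^sub>R (cross7 ?x (d Y) - d (\<i> * Y) + 3 *\<^sub>R cross7 ?U (\<eta> z))"
    unfolding N_def nop_def dJ\<eta> f'_i 1 2 B_def
    by (simp add: cross7.add_right cross7.minus_right cross7.diff_right rules vec_eq_iff)
  then have "cross7 ?x N = (1/2) *\<^sub>R (- d Y - cross7 ?x (d (\<i> * Y)) + 3 *\<^sub>R B z Y (\<eta> z))"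
    by (simp add: B_def cross7.add_right cross7.diff_right cross7.scaleR_right rules)
  then have "nop \<eta> z Y + cross7 ?x N = 2 *\<^sub>R B z Y (\<eta> z)"
    unfolding nop_def d\<eta> B_def by (simp add: vec_eq_iff field_simps)
  moreover have "antilinear_part nabla u s Ch0 z Y
      = cls z ((1/2) *\<^sub>R (nop \<eta> z Y + cross7 ?x N))"
    unfolding antilinear_part_def normal_op_eq[OF nabla lift]
      normal_op_eq[OF nabla lift_nscale_i[OF lift(1)] lift(2)] J\<eta> \<eta>_def[symmetric] N_def
    by (simp add: nscale_cls nadd_cls)
  ultimately show ?thesis by (simp add: \<eta>_def)
qed

lemma A_normal_eq:
  assumes nabla: "J0_connection nabla" and v: "Q v = 0"
  shows "A_normal nabla u Ch0 z (cls z v) Y = cls z (B z Y v)"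
  unfolding A_normal_def
proof (rule the_equality, intro allI impI)
  fix s V assume "z \<in> V \<and> normal_section u Ch0 V s \<and> s (pt Ch0 z) = cls z v"
  then obtain \<xi> where lift: "lift_of u Ch0 V \<xi> s" "z \<in> V" and "s (pt Ch0 z) = cls z v"
    unfolding normal_section_def by blast
  then have "cls z (\<xi> (pt Ch0 z)) = cls z v" by (simp add: lift_of_def)
  then have "P (\<xi> (pt Ch0 z)) = v"
    using cls_eq_iff_P[OF lift_orthogonal[OF lift]] v coassociative_orthogonal P_eq_iff by simp
  then show "cls z (B z Y v) = antilinear_part nabla u s Ch0 z Y"
    using antilinear_part_eq[OF nabla lift] by simp
next
  fix m assume *: "\<forall>s V. z \<in> V \<and> normal_section u Ch0 V s \<and> s (pt Ch0 z) = cls z v \<longrightarrow>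
    m = antilinear_part nabla u s Ch0 z Y"
  \<comment> \<open>A constant vector in the kernel of \<open>Q\<close> is orthogonal to every
    \<open>f w\<close>, so it defines a global section over the chart with the prescribed
    value.\<close>
  let ?s = "\<lambda>p. nclass u p v"
  have lift: "lift_of u Ch0 UNIV (\<lambda>p. v) ?s"
    unfolding lift_of_def pullback_section_def tangent_S6_def
    using v coassociative_orthogonal by (auto intro: smooth_on_const)
  then have "m = antilinear_part nabla u ?s Ch0 z Y"
    using * unfolding normal_section_def by blast
  then show "m = cls z (B z Y v)"
    using antilinear_part_eq[OF nabla lift UNIV_I, of z Y] P_eq_iff[of v] v by simp
qed

section \<open>Clifford algebra of the anti-linear part\<close>

lemma B_coassociative: "Q v = 0 \<Longrightarrow> Q (B z Y v) = 0"
  by (simp add: B_def coassociative_cross7)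

lemma B_cross7: "Q v = 0 \<Longrightarrow> B z Y (cross7 (f z) v) = - cross7 (f z) (B z Y v)"
  unfolding B_def
  by (subst coassociative_anticommute[of "f z" "f' z Y"]) (simp_all add: cross7.minus_right)

text \<open>\<open>B z Y\<close> composes two anticommuting maps whose squares are -1 and minus the
  squared length of \<open>f' z Y\<close>; reordering contributes one more sign.\<close>

lemma B_B:
  assumes "Q v = 0" shows "B z Y (B z Y v) = - ((f' z Y \<bullet> f' z Y) *\<^sub>R v)"
  using B_cross7[of "cross7 (f' z Y) v" z Y] assms
  by (simp add: B_def coassociative_cross7 coassociative_square cross7.minus_right cross7.scaleR_right)

lemma B_i: "Q v = 0 \<Longrightarrow> B z (\<i> * Y) v = - cross7 (f z) (B z Y v)"
  unfolding B_def f'_i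
  by (subst coassociative_assoc[of "f z" "f' z Y"]) (simp_all add: cross7.minus_right)

lemma linear_B: "linear (B z Y)"
  by (rule linearI) (simp_all add: B_def cross7.add_right cross7.scaleR_right)

text \<open>Since \<open>B z Y\<close> is anti-linear, its square is a nonnegative scalar on an invariant complex
  line, whereas it is a negative scalar on the whole normal space.\<close>

lemma B_no_eigenvector:
  assumes v: "Q v = 0" and Y: "Y \<noteq> 0" and B: "B z Y v = r *\<^sub>R v + t *\<^sub>R cross7 (f z) v"
  shows "v = 0"
proof -
  have "B z Y (B z Y v) = B z Y (r *\<^sub>R v + t *\<^sub>R cross7 (f z) v)"
    by (simp only: B)
  also have "\<dots> = r *\<^sub>R B z Y v - t *\<^sub>R cross7 (f z) (B z Y v)"
    by (simp add: linear_add[OF linear_B] linear_scale[OF linear_B] B_cross7 v)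
  \<comment> \<open>Anti-linearity makes the mixed terms cancel: an eigenvalue meets its
    conjugate.\<close>
  also have "\<dots> = (r * r + t * t) *\<^sub>R v"
    unfolding B by (simp add: cross7.add_right cross7.scaleR_right coassociative_square v algebra_simps)
  finally have "(r * r + t * t + f' z Y \<bullet> f' z Y) *\<^sub>R v = 0"
    by (simp add: B_B v neg_eq_iff_add_eq_0 scaleR_add_left add_ac)
  moreover have "f' z Y \<bullet> f' z Y > 0" using Y by simp
  then have "r * r + t * t + f' z Y \<bullet> f' z Y > 0"
    using zero_le_square[of r] zero_le_square[of t] by linarith
  ultimately show ?thesis by simp
qed

lemma no_A_invariant_line_subbundle:
  assumes nabla: "J0_connection nabla" and L: "holomorphic_line_subbundle nabla u L"
  shows "\<not> A_invariant nabla u L"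
proof
  assume inv: "A_invariant nabla u L"
  obtain V s where V: "0 \<in> V" "normal_section u Ch0 V s" "s (pt Ch0 0) \<noteq> nzero u (pt Ch0 0)"
    and L: "L (pt Ch0 0) = {nscale u (pt Ch0 0) c (s (pt Ch0 0)) | c. True}"
    using L unfolding holomorphic_line_subbundle_def holomorphic_section_def by metis
  obtain \<xi> where lift: "lift_of u Ch0 V \<xi> s"
    using V(2) unfolding normal_section_def by blast
  define v where "v = P (\<xi> (pt Ch0 0))"
  have s: "s (pt Ch0 0) = cls 0 v"
    using lift V(1) cls_P[OF lift_orthogonal[OF lift V(1)]] by (simp add: lift_of_def v_def)
  have Qv: "Q v = 0" by (simp add: v_def)
  have "v \<noteq> 0" using V(3) s nzero_eq by auto
  have "cls 0 v = nscale u (pt Ch0 0) 1 (cls 0 v)" by (simp add: nscale_cls)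
  then have "cls 0 v \<in> L (pt Ch0 0)" unfolding L s by blast
  then have "A_normal nabla u Ch0 0 (cls 0 v) 1 \<in> L (pt Ch0 0)"
    using inv unfolding A_invariant_def by blast
  then obtain c where "cls 0 (B 0 1 v) = cls 0 (Re c *\<^sub>R v + Im c *\<^sub>R cross7 (f 0) v)"
    unfolding A_normal_eq[OF nabla Qv] L s nscale_cls by blast
  then have "B 0 1 v = Re c *\<^sub>R v + Im c *\<^sub>R cross7 (f 0) v"
    by (subst (asm) cls_coassociative_eq_iff)
      (simp_all add: B_coassociative Qv Q.add Q.scaleR coassociative_cross7)
  with B_no_eigenvector[OF Qv _ this] \<open>v \<noteq> 0\<close> show False by simp
qed

end

section \<open>The operator norm of the anti-linear part\<close>

lemma (in associative_frame) exists_coassociative: "\<exists>v. v \<noteq> 0 \<and> Q v = 0"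
proof -
  have "dim {a, b, ab} \<le> card {a, b, ab}"
    by (rule dim_le_card') simp
  also have "\<dots> \<le> 3" by (simp add: card_insert_if)
  finally have "dim {a, b, ab} < DIM(imO)" by simp
  from orthogonal_to_subspace_exists[OF this]
  obtain v where "v \<noteq> 0" "\<And>y. y \<in> span {a, b, ab} \<Longrightarrow> orthogonal v y" by metis
  then have "v \<bullet> a = 0" "v \<bullet> b = 0" "v \<bullet> ab = 0"
    unfolding orthogonal_def by (simp_all add: span_base)
  then have "Q v = 0" by (simp add: assoc_proj_def)
  with \<open>v \<noteq> 0\<close> show ?thesis by blast
qed

lemma hermitian_metric_cp1_i:
  assumes "hermitian_metric_cp1 g"
  shows "g b z \<i> \<i> = g b z 1 1" "g b z 1 \<i> = 0" "g b z 1 1 > 0"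
proof -
  note g = assms[unfolded hermitian_metric_cp1_def, THEN conjunct2]
  note bilinear = g[THEN conjunct1, rule_format, of b z]
  note sym = g[THEN conjunct2, THEN conjunct1, rule_format, of b z]
  note pos = g[THEN conjunct2, THEN conjunct2, THEN conjunct1, rule_format, of 1 b z]
  note inv = g[THEN conjunct2, THEN conjunct2, THEN conjunct2, THEN conjunct1, rule_format, of b z]
  show "g b z \<i> \<i> = g b z 1 1" using inv[of 1 1] by simp
  from bilinear have "g b z \<i> (- 1) = - g b z \<i> 1" by (rule bilinear_rneg)
  with inv[of 1 \<i>] sym[of 1 \<i>] show "g b z 1 \<i> = 0" by simp
  show "g b z 1 1 > 0" using pos by simp
qed

lemma area_density_eq:
  assumes "hermitian_metric_cp1 g" shows "area_density g b z = g b z 1 1"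
  using hermitian_metric_cp1_i[OF assms, of b z] by (simp add: area_density_def)

locale normal_metric = totally_geodesic_sphere +
  fixes h and z :: complex
  assumes h: "hermitian_metric_normal u h"
begin

text \<open>Composing with \<open>P\<close> extends the real part of \<open>h\<close> to a bilinear
  form on the whole space; it is an inner product on the kernel of \<open>Q\<close>.\<close>

definition \<beta> :: "imO \<Rightarrow> imO \<Rightarrow> real" where
  "\<beta> v w = Re (h (pt Ch0 z) (cls z (P v)) (cls z (P w)))"

lemma h_props:
  assumes "Q v = 0" "Q w = 0"
  shows "Q k = 0 \<Longrightarrow> h (pt Ch0 z) (cls z (v + k)) (cls z w)
      = h (pt Ch0 z) (cls z v) (cls z w) + h (pt Ch0 z) (cls z k) (cls z w)"
    and "h (pt Ch0 z) (nscale u (pt Ch0 z) c (cls z v)) (cls z w)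
      = c * h (pt Ch0 z) (cls z v) (cls z w)"
    and "h (pt Ch0 z) (cls z w) (cls z v) = cnj (h (pt Ch0 z) (cls z v) (cls z w))"
    and "v \<noteq> 0 \<Longrightarrow> Re (h (pt Ch0 z) (cls z v) (cls z v)) > 0"
proof -
  have fibre: "cls z v \<in> nfibre u (pt Ch0 z)" "cls z w \<in> nfibre u (pt Ch0 z)"
    using assms unfolding nfibre_eq by auto
  note * = h[unfolded hermitian_metric_normal_def, THEN conjunct1, rule_format, OF fibre]
  show "h (pt Ch0 z) (cls z (v + k)) (cls z w)
      = h (pt Ch0 z) (cls z v) (cls z w) + h (pt Ch0 z) (cls z k) (cls z w)" if "Q k = 0"
    using *[THEN conjunct1] that unfolding nadd_cls[symmetric] nfibre_eq by simp
  show "h (pt Ch0 z) (nscale u (pt Ch0 z) c (cls z v)) (cls z w) = c * h (pt Ch0 z) (cls z v) (cls z w)"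
    by (rule *[THEN conjunct2, THEN conjunct1, rule_format])
  show "h (pt Ch0 z) (cls z w) (cls z v) = cnj (h (pt Ch0 z) (cls z v) (cls z w))"
    by (rule *[THEN conjunct2, THEN conjunct2, THEN conjunct1])
  note * = h[unfolded hermitian_metric_normal_def, THEN conjunct1, rule_format, OF fibre(1,1)]
  show "Re (h (pt Ch0 z) (cls z v) (cls z v)) > 0" if "v \<noteq> 0"
    using *[THEN conjunct2, THEN conjunct2, THEN conjunct2] that
      cls_coassociative_eq_iff[OF assms(1) Q.zero] by (simp add: nzero_eq)
qed

lemma \<beta>_sym: "\<beta> v w = \<beta> w v"
  unfolding \<beta>_def by (subst h_props(3)[OF Q_P Q_P]) simp

lemma bounded_bilinear_\<beta>: "bounded_bilinear \<beta>"
proof -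
  have 1: "\<beta> (v + k) w = \<beta> v w + \<beta> k w" for v k w
    using h_props(1)[OF Q_P Q_P Q_P] by (simp add: \<beta>_def P.add)
  have 2: "\<beta> (r *\<^sub>R v) w = r * \<beta> v w" for r v w
    using h_props(2)[OF Q_P Q_P, of "of_real r"] by (simp add: \<beta>_def P.scaleR nscale_cls)
  have "linear (\<lambda>v. \<beta> v w)" for w by (rule linearI) (simp_all add: 1 2)
  moreover have "linear (\<beta> w)" for w
    by (rule linearI) (simp_all add: 1 2 \<beta>_sym[of w])
  ultimately have "bilinear \<beta>" unfolding bilinear_def by blast
  then show ?thesis by (simp add: bilinear_conv_bounded_bilinear)
qed

sublocale \<beta>: bounded_bilinear \<beta> by (rule bounded_bilinear_\<beta>)

lemma \<beta>_pos: "Q v = 0 \<Longrightarrow> v \<noteq> 0 \<Longrightarrow> \<beta> v v > 0"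
  using h_props(4)[of v v] P_eq_iff[of v] by (simp add: \<beta>_def)

lemma h_self: "Q v = 0 \<Longrightarrow> h (pt Ch0 z) (cls z v) (cls z v) = of_real (\<beta> v v)"
  using arg_cong[OF h_props(3)[of v v], of Im] P_eq_iff[of v] by (simp add: \<beta>_def complex_eq_iff)

lemma \<beta>_J: "Q v = 0 \<Longrightarrow> \<beta> (cross7 (f z) v) (cross7 (f z) v) = \<beta> v v"
proof -
  assume v: "Q v = 0"
  let ?w = "cross7 (f z) v"
  have w: "Q ?w = 0" using v by (simp add: coassociative_cross7)
  have J: "nscale u (pt Ch0 z) \<i> (cls z v) = cls z ?w" by (simp add: nscale_cls)
  have "h (pt Ch0 z) (cls z ?w) (cls z ?w) = \<i> * h (pt Ch0 z) (cls z v) (cls z ?w)"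
    using h_props(2)[OF v w, of \<i>] J by simp
  also have "h (pt Ch0 z) (cls z v) (cls z ?w) = cnj (\<i> * h (pt Ch0 z) (cls z v) (cls z v))"
    by (subst h_props(3)[OF w v]) (use h_props(2)[OF v v, of \<i>] J in simp)
  finally show ?thesis by (simp add: h_self v w complex_eq_iff)
qed

text \<open>The minimum over the compact unit sphere in the kernel of \<open>Q\<close> is
  positive.\<close>

lemma \<beta>_lower_bound: "\<exists>m>0. \<forall>v. Q v = 0 \<longrightarrow> m * (norm v)\<^sup>2 \<le> \<beta> v v"
proof -
  let ?S = "sphere 0 1 \<inter> {v. Q v = 0}"
  have "closed {v. Q v = 0}"
    using continuous_closed_vimage[of "{0}" Q] linear_continuous_at[OF bounded_linear_Q]
    by (simp add: vimage_def)
  then have S: "compact ?S" by (intro compact_Int_closed) auto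
  obtain v where "v \<noteq> 0" "Q v = 0" using exists_coassociative by blast
  then have "v /\<^sub>R norm v \<in> ?S" by (simp add: Q.scaleR)
  then have "?S \<noteq> {}" by blast
  moreover have "continuous_on ?S (\<lambda>v. \<beta> v v)"
    by (intro \<beta>.continuous_on continuous_on_id)
  ultimately obtain s where s: "s \<in> ?S" "\<And>v. v \<in> ?S \<Longrightarrow> \<beta> s s \<le> \<beta> v v"
    using continuous_attains_inf[OF S] by blast
  show ?thesis
  proof (intro exI[of _ "\<beta> s s"] conjI allI impI)
    show "\<beta> s s > 0" using s(1) by (auto intro!: \<beta>_pos)
    fix v assume v: "Q v = 0"
    show "\<beta> s s * (norm v)\<^sup>2 \<le> \<beta> v v"
    proof (cases "v = 0")
      case False
      then have "\<beta> s s \<le> \<beta> (v /\<^sub>R norm v) (v /\<^sub>R norm v)"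
        using v by (intro s(2)) (simp add: Q.scaleR)
      also have "\<dots> = \<beta> v v / (norm v)\<^sup>2"
        by (simp add: \<beta>.scaleR_left \<beta>.scaleR_right power2_eq_square field_simps)
      finally show ?thesis using False by (simp add: field_simps)
    qed (simp add: \<beta>.zero_left)
  qed
qed

text \<open>Needed for the supremum in \<open>A_opnorm\<close> to range over a bounded set, so that
  each value lies below it.\<close>

lemma \<beta>_B_bounded: "\<exists>K. \<forall>v. Q v = 0 \<longrightarrow> \<beta> (B z Y v) (B z Y v) \<le> K * \<beta> v v"
proof -
  obtain m where m: "m > 0" "\<And>v. Q v = 0 \<Longrightarrow> m * (norm v)\<^sup>2 \<le> \<beta> v v"
    using \<beta>_lower_bound by blast
  obtain K where K: "K > 0" "\<And>v w. norm (\<beta> v w) \<le> norm v * norm w * K"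
    using \<beta>.pos_bounded by blast
  obtain C where C: "C > 0" "\<And>v. norm (B z Y v) \<le> C * norm v"
    using linear_bounded_pos[OF linear_B] by metis
  show ?thesis
  proof (intro exI[of _ "K * C\<^sup>2 / m"] allI impI)
    fix v assume v: "Q v = 0"
    have "\<beta> (B z Y v) (B z Y v) \<le> K * (norm (B z Y v))\<^sup>2"
      using K(2)[of "B z Y v" "B z Y v"] by (simp add: power2_eq_square ac_simps)
    also have "\<dots> \<le> K * (C * norm v)\<^sup>2"
      using K(1) C by (intro mult_left_mono power_mono) auto
    also have "\<dots> = K * C\<^sup>2 / m * (m * (norm v)\<^sup>2)"
      using m(1) by (simp add: power_mult_distrib)
    also have "\<dots> \<le> K * C\<^sup>2 / m * \<beta> v v"
      using m v K(1) by (intro mult_left_mono) auto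
    finally show "\<beta> (B z Y v) (B z Y v) \<le> K * C\<^sup>2 / m * \<beta> v v" .
  qed
qed

text \<open>The factor 2 arises here: up to sign \<open>B z \<i> v\<close> is the complex structure
  applied to \<open>B z 1 v\<close>, and \<open>\<beta>\<close> is invariant under it.\<close>

lemma form_norm2_eq:
  assumes nabla: "J0_connection nabla" and g: "hermitian_metric_cp1 g" and v: "Q v = 0"
  shows "form_norm2 g h Ch0 z (A_normal nabla u Ch0 z (cls z v))
    = 2 * \<beta> (B z 1 v) (B z 1 v) / g Ch0 z 1 1"
proof -
  have "\<beta> (B z \<i> v) (B z \<i> v) = \<beta> (B z 1 v) (B z 1 v)"
    using B_i[OF v, of z 1] \<beta>_J[OF B_coassociative[OF v]]
    by (simp add: \<beta>.minus_left \<beta>.minus_right)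
  moreover have "Re (h (pt Ch0 z) (A_normal nabla u Ch0 z (cls z v) Y) (A_normal nabla u Ch0 z (cls z v) Y))
      = \<beta> (B z Y v) (B z Y v)" for Y
    by (simp add: A_normal_eq[OF nabla v] h_self B_coassociative v)
  ultimately show ?thesis
    unfolding form_norm2_def using hermitian_metric_cp1_i[OF g] by simp
qed

text \<open>The operator norm of the square \<open>- norm (f' z 1) ^ 2\<close> of \<open>B z 1\<close> is at most the square of
  that of \<open>B z 1\<close>, for any choice of \<open>h\<close>; so either an arbitrary unit vector or its normalized
  image gives the lower bound.\<close>

lemma exists_unit_B:
  "\<exists>v. Q v = 0 \<and> \<beta> v v = 1 \<and> \<beta> (B z 1 v) (B z 1 v) \<ge> (norm (f' z 1))\<^sup>2"
proof -
  define r where "r = (norm (f' z 1))\<^sup>2"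
  have normalize: "Q (v /\<^sub>R sqrt (\<beta> v v)) = 0" "\<beta> (v /\<^sub>R sqrt (\<beta> v v)) (v /\<^sub>R sqrt (\<beta> v v)) = 1"
      "\<beta> (B z 1 (v /\<^sub>R sqrt (\<beta> v v))) (B z 1 (v /\<^sub>R sqrt (\<beta> v v)))
        = \<beta> (B z 1 v) (B z 1 v) / \<beta> v v"
    if "Q v = 0" "v \<noteq> 0" for v
    using \<beta>_pos[OF that] that(1)
    by (simp_all add: Q.scaleR \<beta>.scaleR_left \<beta>.scaleR_right linear_scale[OF linear_B] field_simps)
  obtain v0 where "v0 \<noteq> 0" "Q v0 = 0" using exists_coassociative by blast
  then obtain v where v: "Q v = 0" "\<beta> v v = 1" using normalize by blast
  have r: "r > 0" by (simp add: r_def)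
  have BB: "B z 1 (B z 1 v) = - (r *\<^sub>R v)"
    by (simp add: B_B v r_def power2_norm_eq_inner)
  show ?thesis
  proof (cases "\<beta> (B z 1 v) (B z 1 v) \<ge> r")
    case True
    then show ?thesis using v r_def by blast
  next
    case False
    have w: "Q (B z 1 v) = 0" "B z 1 v \<noteq> 0"
      using BB r v by (auto simp: B_coassociative linear_0[OF linear_B] \<beta>.zero_left)
    have pos: "\<beta> (B z 1 v) (B z 1 v) > 0" by (rule \<beta>_pos[OF w])
    \<comment> \<open>The image of \<open>v\<close> has \<open>\<beta>\<close>-square below
      \<open>r\<close>, but a second application gives \<open>r * r\<close>, so the quotient exceeds
      \<open>r\<close>.\<close>
    have "\<beta> (B z 1 (B z 1 v)) (B z 1 (B z 1 v)) = r * r"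
      by (simp add: BB \<beta>.minus_left \<beta>.minus_right \<beta>.scaleR_left \<beta>.scaleR_right v)
    moreover have "r * r / \<beta> (B z 1 v) (B z 1 v) \<ge> r"
      using False pos r by (simp add: pos_le_divide_eq)
    ultimately show ?thesis
      using normalize[OF w] r_def by (intro exI[of _ "B z 1 v /\<^sub>R sqrt (\<beta> (B z 1 v) (B z 1 v))"]) simp
  qed
qed

text \<open>The form norm carries the inverse of \<open>g Ch0 z 1 1\<close>, which the area density
  cancels.\<close>

lemma A_opnorm_lower_bound:
  assumes nabla: "J0_connection nabla" and g: "hermitian_metric_cp1 g"
  shows "2 * (norm (f' z 1))\<^sup>2 \<le> (A_opnorm nabla u g h Ch0 z)\<^sup>2 * area_density g Ch0 z"
proof -
  define F where "F n = form_norm2 g h Ch0 z (A_normal nabla u Ch0 z n)" for n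
  let ?N = "{n \<in> nfibre u (pt Ch0 z). h (pt Ch0 z) n n = 1}"
  have g11: "g Ch0 z 1 1 > 0" using hermitian_metric_cp1_i[OF g] by simp
  obtain K where K: "\<And>v. Q v = 0 \<Longrightarrow> \<beta> (B z 1 v) (B z 1 v) \<le> K * \<beta> v v"
    using \<beta>_B_bounded by blast
  have bdd: "bdd_above ((\<lambda>n. sqrt (F n)) ` ?N)"
  proof (rule bdd_aboveI2)
    fix n assume n: "n \<in> ?N"
    then obtain v where v: "n = cls z v" "Q v = 0" unfolding nfibre_eq by blast
    then have "\<beta> v v = 1" using n h_self by simp
    then show "sqrt (F n) \<le> sqrt (2 * K / g Ch0 z 1 1)"
      using K[OF v(2)] g11 unfolding F_def v(1) form_norm2_eq[OF nabla g v(2)]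
      by (simp add: divide_right_mono)
  qed
  obtain v where v: "Q v = 0" "\<beta> v v = 1" "\<beta> (B z 1 v) (B z 1 v) \<ge> (norm (f' z 1))\<^sup>2"
    using exists_unit_B by blast
  have "cls z v \<in> ?N" using v h_self unfolding nfibre_eq by simp
  then have "sqrt (F (cls z v)) \<le> A_opnorm nabla u g h Ch0 z"
    unfolding A_opnorm_def F_def[symmetric] by (rule cSUP_upper[OF _ bdd])
  moreover have F: "F (cls z v) = 2 * \<beta> (B z 1 v) (B z 1 v) / g Ch0 z 1 1"
    unfolding F_def by (rule form_norm2_eq[OF nabla g v(1)])
  have F0: "F (cls z v) \<ge> 0"
    unfolding F using g11 order_trans[OF zero_le_power2 v(3)] by simp
  ultimately have "F (cls z v) \<le> (A_opnorm nabla u g h Ch0 z)\<^sup>2"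
    using power_mono[of "sqrt (F (cls z v))" _ 2] by simp
  then have "F (cls z v) * g Ch0 z 1 1 \<le> (A_opnorm nabla u g h Ch0 z)\<^sup>2 * g Ch0 z 1 1"
    using g11 by simp
  moreover have "F (cls z v) * g Ch0 z 1 1 = 2 * \<beta> (B z 1 v) (B z 1 v)"
    unfolding F using g11 by simp
  ultimately show ?thesis
    using v(3) unfolding area_density_eq[OF g] by linarith
qed

end

section \<open>The area of a totally geodesic sphere\<close>

text \<open>Determinants and the measure of differentiable images are handled on
  \<open>real^2\<close>, whereas the chart is \<open>complex\<close>.\<close>

definition cplx :: "real^2 \<Rightarrow> complex" where "cplx v = Complex (v $ 1) (v $ 2)"

lemma linear_cplx: "linear cplx"
  by (rule linearI) (simp_all add: cplx_def complex_eq_iff)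

lemma bounded_linear_cplx: "bounded_linear cplx"
  using linear_cplx by (simp add: linear_conv_bounded_linear)

lemma cplx_eq_0_iff [simp]: "cplx v = 0 \<longleftrightarrow> v = 0"
  by (simp add: cplx_def complex_eq_iff vec_eq_iff forall_2)

lemma cplx_axis [simp]: "cplx (axis 1 1) = 1" "cplx (axis 2 1) = \<i>"
  by (simp_all add: cplx_def complex_eq_iff axis_def)

lemma surj_cplx: "z = cplx (vector [Re z, Im z])"
  by (simp add: cplx_def complex_eq_iff)

lemma lborel_cplx: "lborel = distr lborel borel cplx"
proof (rule lborel_eqI)
  have Basis2: "(Basis :: (real^2) set) = {axis 1 1, axis 2 1}"
    by (auto simp: Basis_vec_def UNIV_2)
  have cont: "continuous_on UNIV cplx"
    by (rule linear_continuous_on[OF bounded_linear_cplx])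
  have meas: "cplx \<in> borel_measurable borel"
    by (rule borel_measurable_continuous_onI[OF cont])
  show "sets (distr lborel borel cplx) = sets borel" by simp
  fix l u :: complex assume le: "\<And>b. b \<in> Basis \<Longrightarrow> l \<bullet> b \<le> u \<bullet> b"
  let ?l = "vector [Re l, Im l] :: real^2" and ?u = "vector [Re u, Im u] :: real^2"
  have "cplx -` box l u = box ?l ?u"
    by (auto simp: mem_box Basis2 Basis_complex_def cplx_def inner_axis)
  then have "emeasure (distr lborel borel cplx) (box l u) = emeasure lborel (box ?l ?u)"
    by (subst emeasure_distr) (use meas in auto)
  also have "\<dots> = (\<Prod>b\<in>Basis. (?u - ?l) \<bullet> b)"
    using le[of 1] le[of \<i>] by (intro emeasure_lborel_box) (auto simp: Basis2 inner_axis)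
  also have "(\<Prod>b\<in>Basis. (?u - ?l) \<bullet> b) = (\<Prod>b\<in>Basis. (u - l) \<bullet> b)"
    by (simp add: Basis2 Basis_complex_def inner_axis axis_eq_axis complex_eq_iff)
  finally show "emeasure (distr lborel borel cplx) (box l u) = (\<Prod>b\<in>Basis. (u - l) \<bullet> b)" .
qed

lemma nn_integral_cplx:
  assumes "f \<in> borel_measurable borel"
  shows "(\<integral>\<^sup>+ v. f (cplx v) \<partial>lborel) = (\<integral>\<^sup>+ z. f z \<partial>lborel)"
proof -
  have "cplx \<in> borel_measurable borel"
    by (rule borel_measurable_continuous_onI[OF linear_continuous_on[OF bounded_linear_cplx]])
  then show ?thesis
    using assms by (subst lborel_cplx) (simp add: nn_integral_distr)
qed

text \<open>Bounds a Jacobian by half the sum of the squared lengths of its columns.\<close>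

lemma abs_2x2_det_le:
  fixes p q r s :: real
  shows "\<bar>p * s - q * r\<bar> \<le> (p\<^sup>2 + q\<^sup>2 + r\<^sup>2 + s\<^sup>2) / 2"
proof -
  have "0 \<le> (p - s)\<^sup>2 + (q + r)\<^sup>2" "0 \<le> (p + s)\<^sup>2 + (q - r)\<^sup>2" by simp_all
  then show ?thesis by (simp add: power2_eq_square algebra_simps abs_if)
qed

lemma norm_vec2: "(norm x)\<^sup>2 = (x $ 1)\<^sup>2 + (x $ 2)\<^sup>2" for x :: "real^2"
  unfolding power2_norm_eq_inner inner_vec_def by (simp add: sum_2 power2_eq_square)

section \<open>Projection of the sphere to a plane\<close>

context totally_geodesic_sphere
begin

text \<open>Coordinates in the tangent plane at \<open>f 0\<close>; the equator consists of the
  points orthogonal to \<open>f 0\<close>.\<close>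

definition proj2 :: "imO \<Rightarrow> real^2" where
  "proj2 w = vector [w \<bullet> e 0, w \<bullet> cross7 (f 0) (e 0)]"

definition F :: "real^2 \<Rightarrow> real^2" where
  "F v = proj2 (f (cplx v))"

definition F' :: "real^2 \<Rightarrow> real^2 \<Rightarrow> real^2" where
  "F' v w = proj2 (f' (cplx v) (cplx w))"

lemma linear_proj2: "linear proj2"
  by (rule linearI) (simp_all add: proj2_def vec_eq_iff forall_2 inner_add_left)

lemma bounded_linear_proj2: "bounded_linear proj2"
  using linear_proj2 by (simp add: linear_conv_bounded_linear)

lemma norm_proj2: "Q w = w \<Longrightarrow> w \<bullet> w = (w \<bullet> f 0)\<^sup>2 + (norm (proj2 w))\<^sup>2"
proof -
  assume "Q w = w"
  then have "w \<bullet> w = w \<bullet> Q w" by simp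
  then show ?thesis
    unfolding norm_vec2 by (simp add: assoc_proj_def inner_add_right proj2_def power2_eq_square)
qed

lemma F_has_derivative: "(F has_derivative F' v) (at v)"
proof -
  have "(cplx has_derivative cplx) (at v)"
    by (rule bounded_linear_imp_has_derivative[OF bounded_linear_cplx])
  from has_derivative_compose[OF this pseudoholomorphic_has_derivative[OF ph, of Ch0 "cplx v"]]
  show ?thesis
    unfolding F_def[abs_def] F'_def[abs_def]
    by (rule bounded_linear.has_derivative[OF bounded_linear_proj2])
qed

lemma F_continuous: "continuous_on S F"
  by (intro continuous_at_imp_continuous_on ballI has_derivative_continuous[OF F_has_derivative])

text \<open>A point over the open disc is off the equator. There a vector killed by
  \<open>F' v\<close> would be a multiple of \<open>f 0\<close> and orthogonal to
  \<open>f (cplx v)\<close>, hence zero; an invertible derivative makes the value interior.\<close>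

lemma F_interior:
  assumes "norm (F v) < 1" shows "F v \<in> interior (range F)"
proof -
  have f0: "f (cplx v) \<bullet> f 0 \<noteq> 0"
  proof
    assume "f (cplx v) \<bullet> f 0 = 0"
    then have "(norm (F v))\<^sup>2 = 1"
      using norm_proj2[OF Q_f, of "cplx v"] by (simp add: F_def)
    then have "norm (F v) = 1" by (simp add: power2_eq_iff_nonneg[of _ 1, simplified])
    with assms show False by simp
  qed
  have lin: "linear (F' v)"
    by (rule has_derivative_linear[OF F_has_derivative])
  have "w = 0" if "F' v w = 0" for w
  proof -
    let ?d = "f' (cplx v) (cplx w)"
    have 0: "?d \<bullet> e 0 = 0" "?d \<bullet> cross7 (f 0) (e 0) = 0"
      using that by (simp_all add: F'_def proj2_def vec_eq_iff forall_2)
    then have d: "?d = (?d \<bullet> f 0) *\<^sub>R f 0"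
      using Q_f'[of "cplx v" "cplx w"] by (simp add: assoc_proj_def)
    then have "(?d \<bullet> f 0) * (f 0 \<bullet> f (cplx v)) = ?d \<bullet> f (cplx v)"
      by (metis inner_scaleR_left)
    then have "?d \<bullet> f 0 = 0" using f0 by (simp add: inner_commute)
    with d have "?d = 0" by simp
    then show ?thesis by simp
  qed
  then have "inj (F' v)" using linear_injective_0[OF lin] by blast
  then have "surj (F' v)" using linear_injective_imp_surjective[OF lin] by blast
  then obtain g where g: "linear g" "F' v \<circ> g = id"
    using linear_surjective_right_inverse[OF lin] by blast
  then have "bounded_linear g" by (simp add: linear_conv_bounded_linear)
  from sussmann_open_mapping[OF open_UNIV F_continuous UNIV_I F_has_derivative this g(2), of UNIV]
  show ?thesis by simp
qed

lemma u_pt_Ch0_or: "u (pt Ch1 w) \<in> range f \<or> w = 0"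
  using pt_transition[of "1 / w"] by (cases "w = 0") (auto intro!: rangeI image_eqI[of _ _ "1 / w"])

text \<open>The image of the sphere under the projection is compact, and the part of it in the open
  disc is open, because the projection is a local diffeomorphism away from the equator. The point
  at infinity of the chart is left out by deleting its image.\<close>

lemma disc_subset_range_F: "ball 0 1 - {proj2 (u (pt Ch1 0))} \<subseteq> range F"
proof -
  define q where "q = proj2 (u (pt Ch1 0))"
  let ?D = "ball 0 1 - {q}"
  have range_F: "range F = proj2 ` range f"
  proof -
    have "range cplx = UNIV" using surj_cplx by blast
    then show ?thesis unfolding F_def[abs_def] by (metis image_image)
  qed
  have "continuous_on S (\<lambda>w. proj2 (u (pt b w)))" for b S
  proof -
    have "continuous_on S (\<lambda>w. u (pt b w))"
      by (intro continuous_at_imp_continuous_on ballI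
          has_derivative_continuous[OF pseudoholomorphic_has_derivative[OF ph]])
    then show ?thesis by (rule bounded_linear.continuous_on[OF bounded_linear_proj2])
  qed
  then have compact: "compact ((\<lambda>w. proj2 (u (pt b w))) ` cball 0 1)" for b
    by (intro compact_continuous_image) auto
  \<comment> \<open>The closed unit discs of the two charts cover the projective line.\<close>
  have "compact ((\<lambda>w. proj2 (f w)) ` cball 0 1 \<union> (\<lambda>w. proj2 (u (pt Ch1 w))) ` cball 0 1)"
    by (rule compact_Un[OF compact compact])
  moreover have "(\<lambda>w. proj2 (f w)) ` cball 0 1 \<union> (\<lambda>w. proj2 (u (pt Ch1 w))) ` cball 0 1
      = insert q (range F)" (is "?L = ?R")
  proof
    show "?L \<subseteq> ?R"
      unfolding range_F q_def using u_pt_Ch0_or by auto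
    have "proj2 (f w) \<in> ?L" for w
    proof (cases "norm w \<le> 1")
      case False
      then have "w \<noteq> 0" by auto
      then have "f w = u (pt Ch1 (1 / w))" by (simp only: pt_transition[OF \<open>w \<noteq> 0\<close>])
      moreover have "1 / w \<in> cball 0 1" using False \<open>w \<noteq> 0\<close> by (simp add: norm_divide divide_le_eq)
      ultimately show ?thesis by (intro UnI2 image_eqI[where x = "1 / w"]) simp_all
    qed simp
    moreover have "q \<in> ?L" unfolding q_def by (intro UnI2 imageI) simp
    ultimately show "?R \<subseteq> ?L" unfolding range_F by blast
  qed
  ultimately have "closed (insert q (range F))" by (simp add: compact_imp_closed)
  then have "openin (top_of_set ?D) (?D \<inter> - insert q (range F))"
    by (intro openin_open_Int open_Compl)
  then have 1: "openin (top_of_set ?D) (?D - insert q (range F))"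
    by (simp only: Diff_eq)
  have "?D \<inter> range F = ?D \<inter> interior (range F)"
  proof
    show "?D \<inter> range F \<subseteq> ?D \<inter> interior (range F)"
    proof
      fix x assume x: "x \<in> ?D \<inter> range F"
      then obtain v where "x = F v" "norm (F v) < 1" by auto
      then show "x \<in> ?D \<inter> interior (range F)" using F_interior x by simp
    qed
  qed (use interior_subset in blast)
  then have 2: "openin (top_of_set ?D) (?D \<inter> range F)"
    by (simp only: openin_open_Int[OF open_interior])
  have conn: "connected ?D"
    by (intro connected_open_delete) (auto simp: convex_connected)
  \<comment> \<open>The centre of the disc starts the connectedness argument: \<open>f 0\<close> is
    orthogonal to the plane.\<close>
  have "F 0 = 0"
    by (simp add: F_def proj2_def linear_0[OF linear_cplx] vec_eq_iff forall_2)
  then have "0 \<in> interior (range F)"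
    using F_interior[of 0] by simp
  then obtain d where d: "d > 0" "ball 0 d \<subseteq> range F"
    by (auto simp: mem_interior)
  \<comment> \<open>The deleted point may itself lie near the centre, so another point of the
    neighbourhood is chosen.\<close>
  have "infinite (ball (0 :: real^2) (min d 1))"
    by (intro uncountable_infinite uncountable_ball) (use d in simp)
  then have "\<not> ball 0 (min d 1) \<subseteq> {q}"
    using finite_subset by blast
  then obtain x where "x \<in> ball 0 (min d 1)" "x \<noteq> q" by blast
  then have "x \<in> ?D \<inter> range F" using d(2) by auto
  then have ne: "?D \<inter> range F \<noteq> {}" by blast
  have "?D \<subseteq> (?D \<inter> range F) \<union> (?D - insert q (range F))"
      "(?D \<inter> range F) \<inter> (?D - insert q (range F)) = {}"
    by blast+
  with conn[unfolded connected_openin] 1 2 ne have "?D - insert q (range F) = {}"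
    by metis
  then show ?thesis unfolding q_def by blast
qed

lemma continuous_f': "continuous_on S (\<lambda>z. f' z Y)"
proof -
  have "smooth_on UNIV (\<lambda>z. f' z Y)"
    using ph smooth_on_frechet_derivative unfolding du_def pseudoholomorphic_def by blast
  then show ?thesis using smooth_on_continuous continuous_on_subset by blast
qed

lemma norm_f'_i: "norm (f' z \<i>) = norm (f' z 1)"
proof -
  have "(norm (f' z \<i>))\<^sup>2 = (norm (f' z 1))\<^sup>2"
    using f'_i[of z 1] norm_cross7[of "f z" "f' z 1"] power2_norm_eq_inner[of "f z"] by simp
  then show ?thesis by simp
qed

text \<open>The projection does not increase area: its Jacobian is at most the area density of
  \<open>f\<close>, and the integral of the Jacobian bounds the measure of the image.\<close>

lemma area_lower_bound: "ennreal pi \<le> (\<integral>\<^sup>+ z. ennreal ((norm (f' z 1))\<^sup>2) \<partial>lborel)"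
proof -
  define r where "r z = (norm (f' z 1))\<^sup>2" for z
  define D where "D v = \<bar>det (matrix (F' v))\<bar>" for v
  have r_cont: "continuous_on UNIV r"
    unfolding r_def[abs_def] by (intro continuous_intros continuous_f')
  have F'_entry: "matrix (F' v) $ i $ j = F' v (axis j 1) $ i" for v i j
    by (simp add: matrix_def)
  have D_eq: "D v = \<bar>F' v (axis 1 1) $ 1 * F' v (axis 2 1) $ 2 - F' v (axis 2 1) $ 1 * F' v (axis 1 1) $ 2\<bar>" for v
    by (simp add: D_def det_2 F'_entry)
  have norm_F': "(F' v w $ 1)\<^sup>2 + (F' v w $ 2)\<^sup>2 \<le> (norm (f' (cplx v) (cplx w)))\<^sup>2" for v w
    using norm_proj2[OF Q_f'[of "cplx v" "cplx w"]]
    by (simp add: F'_def norm_vec2[symmetric] dot_square_norm)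
  \<comment> \<open>The columns are projections of \<open>f'\<close> at \<open>1\<close> and
    \<open>\<i>\<close>, whose lengths agree, so half the sum of their squares is at most
    \<open>r\<close>.\<close>
  have D_le: "D v \<le> r (cplx v)" for v
    using norm_F'[of v "axis 1 1"] norm_F'[of v "axis 2 1"] norm_f'_i[of "cplx v"]
      abs_2x2_det_le[of "F' v (axis 1 1) $ 1" "F' v (axis 2 1) $ 2" "F' v (axis 2 1) $ 1" "F' v (axis 1 1) $ 2"]
    unfolding D_eq by (simp add: r_def)
  have cplx_cont: "continuous_on UNIV cplx"
    by (rule linear_continuous_on[OF bounded_linear_cplx])
  have rc_cont: "continuous_on UNIV (\<lambda>v. r (cplx v))"
    by (rule continuous_on_compose2[OF r_cont cplx_cont]) simp
  have D_cont: "continuous_on UNIV D"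
  proof -
    have "continuous_on UNIV (\<lambda>v. F' v w)" for w
      unfolding F'_def
      by (rule bounded_linear.continuous_on[OF bounded_linear_proj2
          continuous_on_compose2[OF continuous_f' cplx_cont subset_UNIV]])
    then show ?thesis unfolding D_eq[abs_def] by (intro continuous_intros)
  qed
  have int_eq: "(\<integral>\<^sup>+ z. ennreal (r z) \<partial>lborel) = (\<integral>\<^sup>+ v. ennreal (r (cplx v)) \<partial>lborel)"
    using borel_measurable_continuous_onI[OF r_cont] by (subst nn_integral_cplx) auto
  have "ennreal pi \<le> (\<integral>\<^sup>+ v. ennreal (r (cplx v)) \<partial>lborel)"
  proof (cases "(\<integral>\<^sup>+ v. ennreal (r (cplx v)) \<partial>lborel) = \<infinity>")
    \<comment> \<open>Finiteness of the integral makes the Jacobian integrable, as the estimate for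
      differentiable images requires.\<close>
    case False
    have r_int: "integrable lborel (\<lambda>v. r (cplx v))"
    proof (rule integrableI_bounded)
      show "(\<lambda>v. r (cplx v)) \<in> borel_measurable lborel"
        using borel_measurable_continuous_onI[OF rc_cont] by simp
      show "(\<integral>\<^sup>+ v. ennreal (norm (r (cplx v))) \<partial>lborel) < \<infinity>"
        using False by (simp add: r_def less_top)
    qed
    have D_int: "integrable lborel D"
      by (rule Bochner_Integration.integrable_bound[OF r_int])
        (use borel_measurable_continuous_onI[OF D_cont] D_le in
          \<open>auto simp: D_def r_def intro!: AE_I2\<close>)
    have D_on: "(\<lambda>v. \<bar>det (matrix (F' v))\<bar>) integrable_on UNIV"
      using integrable_on_lborel[OF D_int] unfolding D_def .
    have der: "(F has_derivative F' v) (at v within UNIV)" for v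
      using F_has_derivative by simp
    note image = measurable_differentiable_image[OF _ der D_on]
        measure_differentiable_image[OF _ der D_on]
    have "pi = measure lebesgue (ball (0 :: real^2) 1 - {proj2 (u (pt Ch1 0))})"
      by (subst measure_Diff_null_set) (auto simp: content_ball unit_ball_vol_2)
    also have "\<dots> \<le> measure lebesgue (range F)"
      using image(1) by (intro measure_mono_fmeasurable disc_subset_range_F) auto
    also have "\<dots> \<le> integral UNIV D"
      using image(2) by (simp add: D_def[abs_def])
    also have "\<dots> \<le> integral UNIV (\<lambda>v. r (cplx v))"
      by (intro integral_le integrable_on_lborel D_int r_int D_le)
    also have "\<dots> = (\<integral>v. r (cplx v) \<partial>lborel)"
      by (rule integral_lborel[OF r_int])
    finally have "ennreal pi \<le> ennreal (\<integral>v. r (cplx v) \<partial>lborel)"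
      by (rule ennreal_leI)
    also have "\<dots> = (\<integral>\<^sup>+ v. ennreal (r (cplx v)) \<partial>lborel)"
      by (rule nn_integral_eq_integral[symmetric, OF r_int]) (simp add: r_def)
    finally show ?thesis .
  qed simp
  then show ?thesis unfolding r_def[symmetric] int_eq .
qed

end

theorem corollary7p5:
  fixes u :: "cp1 \<Rightarrow> imO"
    and nabla :: connection
    and g :: "chart \<Rightarrow> complex \<Rightarrow> complex \<Rightarrow> complex \<Rightarrow> real"
    and h :: "cp1 \<Rightarrow> ncls \<Rightarrow> ncls \<Rightarrow> complex"
  assumes "pseudoholomorphic u" and "immersed u" and "totally_geodesic u"
    and "J0_connection nabla"
    and "hermitian_metric_cp1 g"
    and "hermitian_einstein nabla u g h"
  shows "integral_cp1 g (\<lambda>b z. (A_opnorm nabla u g h b z)\<^sup>2) \<ge> ennreal (2 * pi) \<and>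
    (\<nexists>L. holomorphic_line_subbundle nabla u L \<and> isomorphic_O_minus_1 nabla u L \<and> A_invariant nabla u L)"
proof
  interpret totally_geodesic_sphere u
    using assms(1-3) by unfold_locales
  have h: "hermitian_metric_normal u h"
    using assms(6) by (simp add: hermitian_einstein_def)
  have "ennreal (2 * pi) = 2 * ennreal pi"
    by (simp add: ennreal_mult')
  also have "\<dots> \<le> 2 * (\<integral>\<^sup>+ z. ennreal ((norm (f' z 1))\<^sup>2) \<partial>lborel)"
    by (intro mult_left_mono area_lower_bound) simp
  also have "\<dots> = (\<integral>\<^sup>+ z. 2 * ennreal ((norm (f' z 1))\<^sup>2) \<partial>lborel)"
  proof (rule nn_integral_cmult[symmetric])
    have "continuous_on UNIV (\<lambda>z. (norm (f' z 1))\<^sup>2)"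
      by (intro continuous_intros continuous_f')
    from borel_measurable_continuous_onI[OF this]
    show "(\<lambda>z. ennreal ((norm (f' z 1))\<^sup>2)) \<in> borel_measurable lborel" by simp
  qed
  also have "\<dots> = (\<integral>\<^sup>+ z. ennreal (2 * (norm (f' z 1))\<^sup>2) \<partial>lborel)"
    by (simp add: ennreal_mult')
  also have "\<dots> \<le> integral_cp1 g (\<lambda>b z. (A_opnorm nabla u g h b z)\<^sup>2)"
    unfolding integral_cp1_def
  proof (intro nn_integral_mono ennreal_leI)
    fix z
    interpret normal_metric u h z
      using h by unfold_locales
    show "2 * (norm (f' z 1))\<^sup>2 \<le> (A_opnorm nabla u g h Ch0 z)\<^sup>2 * area_density g Ch0 z"
      by (rule A_opnorm_lower_bound[OF assms(4,5)])
  qed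
  finally show "integral_cp1 g (\<lambda>b z. (A_opnorm nabla u g h b z)\<^sup>2) \<ge> ennreal (2 * pi)" .
  show "\<nexists>L. holomorphic_line_subbundle nabla u L \<and> isomorphic_O_minus_1 nabla u L \<and> A_invariant nabla u L"
    using no_A_invariant_line_subbundle[OF assms(4)] by blast
qed

end
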